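(* Let $k$ be a Noetherian commutative ring, $A$ a filtered $k$-algebra with $A/F^1A=k$ (that is, the composition $k\to A\to A/F^1A$ is an isomorphism), and $C\in\mathbb{AF}_A$. Then there is a canonical isomorphism of filtered $A$-modules $\mathrm{Soc}_k(C)=(C^*\otimes_Ak)^*$.
   Context: A filtered $k$-algebra $A$ has a descending chain of ideals $F^mA$, $m\in\mathbb Z$, with $F^mA=A$ for $m\le0$ and $F^mA\cdot F^nA\subset F^{m+n}A$. A filtered $A$-module $C$ has a descending chain of $A$-submodules $F^nC$ with $F^mA\cdot F^nC\subset F^{m+n}C$; $G_nC:=F^nC/F^{n+1}C$. $\mathbb{AF}_A$ is the category of filtered $A$-modules $C$ with $F^nC=C$ for $n\ll0$, $F^nC=0$ for $n\gg0$, and each $G_nC$ locally free over $k$ of constant finite rank. For a $k$-module $M$, $M^*:=\mathrm{Hom}_k(M,k)$; if $M$ is an $A$-module, so is $M^*$ via $(af)(\psi)=f(a\psi)$; if $M$ is filtered, $F^p(M^* ):=(M/F^{1-p}M)^*$, the functionals vanishing on $F^{1-p}M$. $k$ is an $A$-module via $A\to A/F^1A=k$; $C^*\otimes_Ak=C^*/(F^1A)C^*$ has the filtration induced from $C^*$ as a quotient. The $k$-socle is $\mathrm{Soc}_k(C):=\mathrm{Hom}_A(k,C)=\{c\in C:(F^1A)c=0\}\subset C$, with filtration $F^n(\mathrm{Soc}_k(C)):=\mathrm{Soc}_k(C)\cap F^nC$. *)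

theory Defs
  imports "HOL-Algebra.Module" "HOL-Algebra.QuotRing" "HOL-Algebra.Ring_Divisibility"
begin

text \<open>
  All rings are commutative. A \<open>k\<close>-algebra is the library's \<^locale>\<open>algebra\<close>, i.e. a ring \<open>A\<close>
  carrying a scalar multiplication by \<open>K\<close>; its structure map is \<open>r \<mapsto> r \<odot>\<^bsub>A\<^esub> \<one>\<^bsub>A\<^esub>\<close>. The fields \<open>mult\<close> and
  \<open>one\<close> which module records inherit from ring records have no meaning for modules
  and are left \<^const>\<open>undefined\<close> in the constructions below.
\<close>

section \<open>Module constructions\<close>

definition module_iso ::
  "('a, 'r) ring_scheme \<Rightarrow> ('a, 'b, 'm) module_scheme \<Rightarrow> ('a, 'c, 'n) module_scheme \<Rightarrow> ('b \<Rightarrow> 'c) set"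
  where "module_iso R M N =
    {h. bij_betw h (carrier M) (carrier N) \<and>
        (\<forall>x\<in>carrier M. \<forall>y\<in>carrier M. h (x \<oplus>\<^bsub>M\<^esub> y) = h x \<oplus>\<^bsub>N\<^esub> h y) \<and>
        (\<forall>a\<in>carrier R. \<forall>x\<in>carrier M. h (a \<odot>\<^bsub>M\<^esub> x) = a \<odot>\<^bsub>N\<^esub> h x)}"

definition restrict_scalars ::
  "('k, 'a, 'm) module_scheme \<Rightarrow> ('a, 'b, 'n) module_scheme \<Rightarrow> ('k, 'b) module"
  where "restrict_scalars A M =
    \<lparr>carrier = carrier M, monoid.mult = undefined, one = undefined,
     ring.zero = \<zero>\<^bsub>M\<^esub>, add = add M,
     smult = (\<lambda>r x. (r \<odot>\<^bsub>A\<^esub> \<one>\<^bsub>A\<^esub>) \<odot>\<^bsub>M\<^esub> x)\<rparr>"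

definition quot_module :: "('a, 'b, 'm) module_scheme \<Rightarrow> 'b set \<Rightarrow> ('a, 'b set) module"
  where "quot_module M N =
    \<lparr>carrier = a_rcosets\<^bsub>M\<^esub> N, monoid.mult = undefined, one = undefined,
     ring.zero = N, add = set_add M,
     smult = (\<lambda>a X. \<Union>x\<in>X. N +>\<^bsub>M\<^esub> (a \<odot>\<^bsub>M\<^esub> x))\<rparr>"

text \<open>The submodule \<open>I M\<close> generated by the products of elements of \<open>I\<close> and \<open>M\<close>.\<close>

definition ideal_smult :: "('a, 'r) ring_scheme \<Rightarrow> 'a set \<Rightarrow> ('a, 'b, 'm) module_scheme \<Rightarrow> 'b set"
  where "ideal_smult R I M =
    \<Inter>{N. submodule N R M \<and> (\<forall>a\<in>I. \<forall>x\<in>carrier M. a \<odot>\<^bsub>M\<^esub> x \<in> N)}"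

text \<open>
  Linear forms on a \<open>K\<close>-module; they are \<^const>\<open>extensional\<close>, so that equality of
  forms is equality on the carrier.
\<close>

definition linear_forms :: "('k, 'r) ring_scheme \<Rightarrow> ('k, 'b, 'm) module_scheme \<Rightarrow> ('b \<Rightarrow> 'k) set"
  where "linear_forms K M =
    {f \<in> carrier M \<rightarrow>\<^sub>E carrier K.
        (\<forall>x\<in>carrier M. \<forall>y\<in>carrier M. f (x \<oplus>\<^bsub>M\<^esub> y) = f x \<oplus>\<^bsub>K\<^esub> f y) \<and>
        (\<forall>r\<in>carrier K. \<forall>x\<in>carrier M. f (r \<odot>\<^bsub>M\<^esub> x) = r \<otimes>\<^bsub>K\<^esub> f x)}"

definition dual ::
  "('k, 'r) ring_scheme \<Rightarrow> ('k, 'a, 'm) module_scheme \<Rightarrow> ('a, 'b, 'n) module_scheme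
    \<Rightarrow> ('a, 'b \<Rightarrow> 'k) module"
  where "dual K A M =
    \<lparr>carrier = linear_forms K (restrict_scalars A M), monoid.mult = undefined, one = undefined,
     ring.zero = (\<lambda>x\<in>carrier M. \<zero>\<^bsub>K\<^esub>),
     add = (\<lambda>f g. \<lambda>x\<in>carrier M. f x \<oplus>\<^bsub>K\<^esub> g x),
     smult = (\<lambda>a f. \<lambda>x\<in>carrier M. f (a \<odot>\<^bsub>M\<^esub> x))\<rparr>"


section \<open>Localization and local freeness\<close>

text \<open>Fractions \<open>m / s\<close> with \<open>m \<in> M\<close> and \<open>s\<close> in a multiplicative subset \<open>S\<close> of the ring.\<close>

definition loc_rel :: "'a set \<Rightarrow> ('a, 'b, 'm) module_scheme \<Rightarrow> (('b \<times> 'a) \<times> ('b \<times> 'a)) set"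
  where "loc_rel S M =
    {((m, s), (n, t)). m \<in> carrier M \<and> n \<in> carrier M \<and> s \<in> S \<and> t \<in> S \<and>
       (\<exists>u\<in>S. u \<odot>\<^bsub>M\<^esub> (t \<odot>\<^bsub>M\<^esub> m) = u \<odot>\<^bsub>M\<^esub> (s \<odot>\<^bsub>M\<^esub> n))}"

definition loc_frac :: "'a set \<Rightarrow> ('a, 'b, 'm) module_scheme \<Rightarrow> 'b \<Rightarrow> 'a \<Rightarrow> ('b \<times> 'a) set"
  where "loc_frac S M m s = loc_rel S M `` {(m, s)}"

definition loc_module ::
  "('a, 'r) ring_scheme \<Rightarrow> 'a set \<Rightarrow> ('a, 'b, 'm) module_scheme
    \<Rightarrow> (('a \<times> 'a) set, ('b \<times> 'a) set) module"
  where "loc_module R S M =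
    \<lparr>carrier = (carrier M \<times> S) // loc_rel S M, monoid.mult = undefined, one = undefined,
     ring.zero = loc_frac S M \<zero>\<^bsub>M\<^esub> \<one>\<^bsub>R\<^esub>,
     add = (\<lambda>X Y. \<Union>(m, s)\<in>X. \<Union>(n, t)\<in>Y.
              loc_frac S M ((t \<odot>\<^bsub>M\<^esub> m) \<oplus>\<^bsub>M\<^esub> (s \<odot>\<^bsub>M\<^esub> n)) (s \<otimes>\<^bsub>R\<^esub> t)),
     smult = (\<lambda>X Y. \<Union>(a, s)\<in>X. \<Union>(n, t)\<in>Y. loc_frac S M (a \<odot>\<^bsub>M\<^esub> n) (s \<otimes>\<^bsub>R\<^esub> t))\<rparr>"

definition self_module :: "('a, 'r) ring_scheme \<Rightarrow> ('a, 'a) module"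
  where "self_module R =
    \<lparr>carrier = carrier R, monoid.mult = monoid.mult R, one = \<one>\<^bsub>R\<^esub>, ring.zero = \<zero>\<^bsub>R\<^esub>,
     add = add R, smult = monoid.mult R\<rparr>"

definition loc_ring :: "('a, 'r) ring_scheme \<Rightarrow> 'a set \<Rightarrow> ('a \<times> 'a) set ring"
  where "loc_ring R S = (let L = loc_module R S (self_module R) in
    \<lparr>carrier = carrier L, monoid.mult = smult L,
     one = loc_frac S (self_module R) \<one>\<^bsub>R\<^esub> \<one>\<^bsub>R\<^esub>,
     ring.zero = \<zero>\<^bsub>L\<^esub>, add = add L\<rparr>)"

definition powers :: "('a, 'r) ring_scheme \<Rightarrow> 'a \<Rightarrow> 'a set"
  where "powers R f = range (\<lambda>n::nat. f [^]\<^bsub>R\<^esub> n)"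

definition free_of_rank ::
  "('a, 'r) ring_scheme \<Rightarrow> ('a, 'b, 'm) module_scheme \<Rightarrow> nat \<Rightarrow> bool"
  where "free_of_rank R M r \<longleftrightarrow>
    (\<exists>b \<in> {..<r} \<rightarrow> carrier M. \<forall>x\<in>carrier M.
       \<exists>!a. a \<in> {..<r} \<rightarrow>\<^sub>E carrier R \<and> x = (\<Oplus>\<^bsub>M\<^esub>i\<in>{..<r}. a i \<odot>\<^bsub>M\<^esub> b i))"

text \<open>
  Local freeness on \<open>Spec R\<close>: every prime has a basic open neighbourhood \<open>D(f)\<close> on
  which the module becomes free of the given rank.
\<close>

definition locally_free_of_rank ::
  "('a, 'r) ring_scheme \<Rightarrow> ('a, 'b, 'm) module_scheme \<Rightarrow> nat \<Rightarrow> bool"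
  where "locally_free_of_rank R M r \<longleftrightarrow>
    (\<forall>P. primeideal P R \<longrightarrow>
      (\<exists>f \<in> carrier R - P.
         free_of_rank (loc_ring R (powers R f)) (loc_module R (powers R f) M) r))"


section \<open>Filtered algebras and modules\<close>

locale filtered_algebra = algebra K A
  for K :: "('k, 'r) ring_scheme" and A :: "('k, 'a, 'm) module_scheme" (structure) +
  fixes FA :: "int \<Rightarrow> 'a set"
  assumes filt_ideal: "ideal (FA m) A"
    and filt_desc: "FA (m + 1) \<subseteq> FA m"
    and filt_nonpos: "m \<le> 0 \<Longrightarrow> FA m = carrier A"
    and filt_mult: "\<lbrakk>a \<in> FA m; b \<in> FA n\<rbrakk> \<Longrightarrow> a \<otimes> b \<in> FA (m + n)"

locale filtered_module = module A C
  for A :: "('a, 'r) ring_scheme" and FA :: "int \<Rightarrow> 'a set"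
    and C :: "('a, 'c, 'm) module_scheme" (structure) +
  fixes FC :: "int \<Rightarrow> 'c set"
  assumes filt_submodule: "submodule (FC n) A C"
    and filt_desc: "FC (n + 1) \<subseteq> FC n"
    and filt_smult: "\<lbrakk>a \<in> FA m; x \<in> FC n\<rbrakk> \<Longrightarrow> a \<odot> x \<in> FC (m + n)"

definition gr ::
  "('a, 'c, 'm) module_scheme \<Rightarrow> (int \<Rightarrow> 'c set) \<Rightarrow> int \<Rightarrow> ('a, 'c set) module"
  where "gr C FC n = quot_module (C\<lparr>carrier := FC n\<rparr>) (FC (n + 1))"

text \<open>Membership in the category \<open>AF\<^sub>A\<close>; the rank of \<open>G\<^sub>n C\<close> may depend on \<open>n\<close>.\<close>

definition AF_module ::
  "('k, 'r) ring_scheme \<Rightarrow> ('k, 'a, 'm) module_scheme \<Rightarrow> (int \<Rightarrow> 'a set)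
    \<Rightarrow> ('a, 'c, 'n) module_scheme \<Rightarrow> (int \<Rightarrow> 'c set) \<Rightarrow> bool"
  where "AF_module K A FA C FC \<longleftrightarrow>
    filtered_module A FA C FC \<and>
    (\<exists>N. \<forall>n\<le>N. FC n = carrier C) \<and>
    (\<exists>N. \<forall>n\<ge>N. FC n = {\<zero>\<^bsub>C\<^esub>}) \<and>
    (\<forall>n. \<exists>r. locally_free_of_rank K (restrict_scalars A (gr C FC n)) r)"

definition filtered_module_iso ::
  "('a, 'r) ring_scheme \<Rightarrow> (int \<Rightarrow> 'a set)
    \<Rightarrow> ('a, 'b, 'm) module_scheme \<Rightarrow> (int \<Rightarrow> 'b set)
    \<Rightarrow> ('a, 'c, 'n) module_scheme \<Rightarrow> (int \<Rightarrow> 'c set) \<Rightarrow> ('b \<Rightarrow> 'c) \<Rightarrow> bool"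
  where "filtered_module_iso A FA M FM N FN h \<longleftrightarrow>
    filtered_module A FA M FM \<and> filtered_module A FA N FN \<and>
    h \<in> module_iso A M N \<and> (\<forall>n. h ` FM n = FN n)"

definition dual_filt ::
  "('k, 'r) ring_scheme \<Rightarrow> ('k, 'a, 'm) module_scheme \<Rightarrow> ('a, 'b, 'n) module_scheme
    \<Rightarrow> (int \<Rightarrow> 'b set) \<Rightarrow> int \<Rightarrow> ('b \<Rightarrow> 'k) set"
  where "dual_filt K A M FM p = {f \<in> carrier (dual K A M). \<forall>x\<in>FM (1 - p). f x = \<zero>\<^bsub>K\<^esub>}"

text \<open>\<open>M \<otimes>\<^sub>A k = M / (F\<^sup>1 A) M\<close>, where \<open>k\<close> is an \<open>A\<close>-module via \<open>A \<rightarrow> A / F\<^sup>1 A = k\<close>.\<close>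

definition tensor_k ::
  "('a, 'r) ring_scheme \<Rightarrow> (int \<Rightarrow> 'a set) \<Rightarrow> ('a, 'b, 'm) module_scheme \<Rightarrow> ('a, 'b set) module"
  where "tensor_k A FA M = quot_module M (ideal_smult A (FA 1) M)"

definition tensor_k_proj ::
  "('a, 'r) ring_scheme \<Rightarrow> (int \<Rightarrow> 'a set) \<Rightarrow> ('a, 'b, 'm) module_scheme \<Rightarrow> 'b \<Rightarrow> 'b set"
  where "tensor_k_proj A FA M x = ideal_smult A (FA 1) M +>\<^bsub>M\<^esub> x"

definition tensor_k_filt ::
  "('a, 'r) ring_scheme \<Rightarrow> (int \<Rightarrow> 'a set) \<Rightarrow> ('a, 'b, 'm) module_scheme
    \<Rightarrow> (int \<Rightarrow> 'b set) \<Rightarrow> int \<Rightarrow> 'b set set"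
  where "tensor_k_filt A FA M FM n = tensor_k_proj A FA M ` FM n"

definition Soc :: "(int \<Rightarrow> 'a set) \<Rightarrow> ('a, 'c, 'm) module_scheme \<Rightarrow> 'c set"
  where "Soc FA C = {c \<in> carrier C. \<forall>a\<in>FA 1. a \<odot>\<^bsub>C\<^esub> c = \<zero>\<^bsub>C\<^esub>}"

definition Soc_module ::
  "(int \<Rightarrow> 'a set) \<Rightarrow> ('a, 'c, 'm) module_scheme \<Rightarrow> ('a, 'c, 'm) module_scheme"
  where "Soc_module FA C = C\<lparr>carrier := Soc FA C\<rparr>"

definition Soc_filt ::
  "(int \<Rightarrow> 'a set) \<Rightarrow> ('a, 'c, 'm) module_scheme \<Rightarrow> (int \<Rightarrow> 'c set) \<Rightarrow> int \<Rightarrow> 'c set"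
  where "Soc_filt FA C FC n = Soc FA C \<inter> FC n"

end

theory Submission
  imports Defs
begin

text \<open>
  Write \<open>\<pi> : C\<^sup>* \<rightarrow> C\<^sup>* / (F\<^sup>1 A) C\<^sup>*\<close> for the projection. The map sends \<open>c\<close> to the functional
  \<open>\<pi> f \<mapsto> f c\<close>. It is bijective because functionals on \<open>C\<^sup>* / (F\<^sup>1 A) C\<^sup>*\<close> are the functionals
  on \<open>C\<^sup>*\<close> killed by \<open>F\<^sup>1 A\<close>, and \<open>C\<close> is reflexive over \<open>k\<close>; it matches the filtrations because
  each \<open>C / F\<^sup>n C\<close> is torsionless. Both properties follow once the identity of \<open>C / F\<^sup>n C\<close> is a
  finite sum of maps \<open>x \<mapsto> \<phi> x m\<close>, and such decompositions compose along the filtration, so it suffices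
  to decompose the identity of a locally free module \<open>M\<close>. The \<open>f \<in> k\<close> for which multiplication
  by \<open>f\<close> on \<open>M\<close> is such a sum form an ideal. If \<open>M\<^sub>f\<close> is free, some power of \<open>f\<close> belongs to it: for large
  \<open>N\<close> the map \<open>k \<rightarrow> k\<^sub>f\<close> is injective on \<open>f\<^sup>N k\<close>, as \<open>k\<close> is Noetherian, so that the coordinate
  functions of \<open>M\<^sub>f\<close>, multiplied by a power of \<open>f\<close>, take values in \<open>k\<close>. Hence no prime ideal contains
  the ideal, and it contains \<open>1\<close>.
\<close>

section \<open>Quotients, duals and filtrations\<close>

text \<open>Two uniformity problems shape the local step. Freeness of \<open>M_f\<close> clears the
  denominators of one element at a time, while a coordinate function on \<open>M\<close> needs a
  single power of \<open>f\<close> for all elements; hence \<open>M\<close> is shown to be finitely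
  generated before its identity is decomposed. Moreover the coordinates of an element are determined
  in \<open>k\<close> only up to elements killed by a power of \<open>f\<close>, so a choice of
  coordinates is not linear. It becomes linear after multiplication by a power \<open>f^N\<close>
  that kills all of these elements at once, and the ascending chain condition supplies
  \<open>N\<close>.

  Decompositions are kept relative to submodules \<open>N \<subseteq> H\<close> of one module: the
  forms live on \<open>H\<close> and vanish on \<open>N\<close>, the vectors lie in
  \<open>H\<close>. So the quotients of \<open>C\<close> by its filtration steps are never formed,
  decompositions for successive steps compose by substitution, and only the graded pieces appear as
  modules of cosets, from which decompositions are lifted.\<close>

lemma restrict_scalars_simps [simp]:
  "carrier (restrict_scalars A M) = carrier M" "\<zero>\<^bsub>restrict_scalars A M\<^esub> = \<zero>\<^bsub>M\<^esub>"
  "add (restrict_scalars A M) = add M"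
  "smult (restrict_scalars A M) = (\<lambda>r x. (r \<odot>\<^bsub>A\<^esub> \<one>\<^bsub>A\<^esub>) \<odot>\<^bsub>M\<^esub> x)"
  by (simp_all add: restrict_scalars_def)

lemma (in algebra) module_restrict_scalars:
  assumes "module M N"
  shows "module R (restrict_scalars M N)"
proof -
  interpret N: module M N by fact
  show ?thesis
  proof (rule moduleI[OF R_cring])
    show "abelian_group (restrict_scalars M N)"
      by (rule abelian_groupI) (auto simp: N.M.a_ac intro: N.M.l_neg)
  next
    fix a b x assume "a \<in> carrier R" "b \<in> carrier R" "x \<in> carrier (restrict_scalars M N)"
    moreover have "(a \<otimes> b) \<odot>\<^bsub>M\<^esub> \<one>\<^bsub>M\<^esub> = (a \<odot>\<^bsub>M\<^esub> \<one>\<^bsub>M\<^esub>) \<otimes>\<^bsub>M\<^esub> (b \<odot>\<^bsub>M\<^esub> \<one>\<^bsub>M\<^esub>)"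
      if "a \<in> carrier R" "b \<in> carrier R"
      using that by (simp add: smult_assoc2 smult_assoc1)
    ultimately show "(a \<otimes> b) \<odot>\<^bsub>restrict_scalars M N\<^esub> x =
        a \<odot>\<^bsub>restrict_scalars M N\<^esub> (b \<odot>\<^bsub>restrict_scalars M N\<^esub> x)"
      by (simp add: N.smult_assoc1)
  qed (auto simp: smult_l_distr N.smult_l_distr N.smult_r_distr)
qed

section \<open>Quotient modules and generated submodules\<close>

lemma quot_module_simps [simp]:
  "carrier (quot_module M N) = a_rcosets\<^bsub>M\<^esub> N" "\<zero>\<^bsub>quot_module M N\<^esub> = N"
  "add (quot_module M N) = set_add M"
  by (simp_all add: quot_module_def)

context module
begin

lemma submodule_abelian_subgroup:
  assumes "submodule N R M"
  shows "abelian_subgroup N M"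
  using assms M.abelian_group_axioms
  by (auto intro!: abelian_subgroupI3 additive_subgroupI simp: submodule_def)

lemma submodule_zero: "submodule N R M \<Longrightarrow> \<zero>\<^bsub>M\<^esub> \<in> N"
  using additive_subgroup.zero_closed[OF abelian_subgroup.axioms(1)[OF submodule_abelian_subgroup]]
  by blast

text \<open>Scalar multiplication of cosets is a union over representatives. As \<open>N\<close> is
  stable under \<open>a\<close>, all members of the union are the same coset.\<close>

lemma quot_module_smult:
  assumes N: "submodule N R M" and a: "a \<in> carrier R" and x: "x \<in> carrier M"
  shows "a \<odot>\<^bsub>quot_module M N\<^esub> (N +>\<^bsub>M\<^esub> x) = N +>\<^bsub>M\<^esub> (a \<odot>\<^bsub>M\<^esub> x)"
proof -
  interpret N: abelian_subgroup N M by (rule submodule_abelian_subgroup[OF N])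
  have "N +>\<^bsub>M\<^esub> (a \<odot>\<^bsub>M\<^esub> y) = N +>\<^bsub>M\<^esub> (a \<odot>\<^bsub>M\<^esub> x)" if y: "y \<in> N +>\<^bsub>M\<^esub> x" for y
  proof -
    obtain h where h: "h \<in> N" "y = h \<oplus>\<^bsub>M\<^esub> x"
      using y by (auto simp: a_r_coset_def')
    then have "a \<odot>\<^bsub>M\<^esub> y = a \<odot>\<^bsub>M\<^esub> h \<oplus>\<^bsub>M\<^esub> a \<odot>\<^bsub>M\<^esub> x"
      using a x by (simp add: smult_r_distr)
    moreover have "a \<odot>\<^bsub>M\<^esub> h \<in> N"
      using submoduleE(4)[OF N] a h by blast
    ultimately have "a \<odot>\<^bsub>M\<^esub> y \<in> N +>\<^bsub>M\<^esub> (a \<odot>\<^bsub>M\<^esub> x)"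
      by (auto simp: a_r_coset_def')
    then show ?thesis
      using N.a_repr_independence' a x by force
  qed
  moreover have "x \<in> N +>\<^bsub>M\<^esub> x"
    by (rule N.a_rcos_self[OF x])
  ultimately have "(\<Union>y\<in>N +>\<^bsub>M\<^esub> x. N +>\<^bsub>M\<^esub> (a \<odot>\<^bsub>M\<^esub> y)) = N +>\<^bsub>M\<^esub> (a \<odot>\<^bsub>M\<^esub> x)"
    by blast
  then show ?thesis
    by (simp add: quot_module_def)
qed

lemma rcosetsE:
  assumes "X \<in> a_rcosets\<^bsub>M\<^esub> N"
  obtains x where "x \<in> carrier M" "X = N +>\<^bsub>M\<^esub> x"
  using assms by (auto simp: A_RCOSETS_def')

lemma module_quot_module:
  assumes N: "submodule N R M"
  shows "module R (quot_module M N)"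
proof -
  interpret N: abelian_subgroup N M by (rule submodule_abelian_subgroup[OF N])
  have cl: "N +>\<^bsub>M\<^esub> x \<in> a_rcosets\<^bsub>M\<^esub> N" if "x \<in> carrier M" for x
    using that by (auto simp: A_RCOSETS_def')
  show ?thesis
  proof (rule moduleI[OF R.is_cring])
    show "abelian_group (quot_module M N)"
    proof (rule abelian_groupI)
      fix X assume "X \<in> carrier (quot_module M N)"
      then obtain x where x: "x \<in> carrier M" "X = N +>\<^bsub>M\<^esub> x"
        by (auto elim: rcosetsE)
      have "N +>\<^bsub>M\<^esub> \<zero>\<^bsub>M\<^esub> = N"
        using N.a_subset by simp
      then show "\<zero>\<^bsub>quot_module M N\<^esub> \<oplus>\<^bsub>quot_module M N\<^esub> X = X"
        "\<exists>Y\<in>carrier (quot_module M N). Y \<oplus>\<^bsub>quot_module M N\<^esub> X = \<zero>\<^bsub>quot_module M N\<^esub>"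
        using N.a_rcos_sum[of "\<zero>\<^bsub>M\<^esub>" x] x cl[of "\<ominus>\<^bsub>M\<^esub> x"]
          N.a_rcos_sum[of "\<ominus>\<^bsub>M\<^esub> x" x]
        by (auto simp: M.l_neg)
    qed (auto elim!: rcosetsE simp: cl N.a_rcos_sum M.a_ac N.a_subgroup_in_rcosets)
  qed (auto elim!: rcosetsE simp: cl N quot_module_smult smult_l_distr smult_r_distr
        smult_assoc1 N.a_rcos_sum)
qed

lemma submodule_Inter:
  assumes "\<And>N. N \<in> \<N> \<Longrightarrow> submodule N R M" "\<N> \<noteq> {}"
  shows "submodule (\<Inter>\<N>) R M"
proof (rule submoduleI)
  show "\<Inter>\<N> \<subseteq> carrier M"
    using assms submoduleE(1) by fastforce
  show "\<zero>\<^bsub>M\<^esub> \<in> \<Inter>\<N>"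
    using assms submodule_zero by blast
  show "\<ominus>\<^bsub>M\<^esub> a \<in> \<Inter>\<N>" if "a \<in> \<Inter>\<N>" for a
    using that assms(1) submoduleE(3) by (meson InterD InterI)
  show "a \<oplus>\<^bsub>M\<^esub> b \<in> \<Inter>\<N>" if "a \<in> \<Inter>\<N>" "b \<in> \<Inter>\<N>" for a b
    using that assms(1) submoduleE(5) by (meson InterD InterI)
  show "a \<odot>\<^bsub>M\<^esub> x \<in> \<Inter>\<N>" if "a \<in> carrier R" "x \<in> \<Inter>\<N>" for a x
    using that assms(1) submoduleE(4) by (meson InterD InterI)
qed

lemma submodule_ideal_smult: "submodule (ideal_smult R I M) R M" if "I \<subseteq> carrier R"
  unfolding ideal_smult_def
  by (rule submodule_Inter) (use carrier_is_submodule that in auto)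

lemma ideal_smult_minimal:
  assumes "submodule N R M" "\<And>a x. a \<in> I \<Longrightarrow> x \<in> carrier M \<Longrightarrow> a \<odot>\<^bsub>M\<^esub> x \<in> N"
  shows "ideal_smult R I M \<subseteq> N"
  using assms unfolding ideal_smult_def by blast

lemma ideal_smult_incl: "a \<in> I \<Longrightarrow> x \<in> carrier M \<Longrightarrow> a \<odot>\<^bsub>M\<^esub> x \<in> ideal_smult R I M"
  unfolding ideal_smult_def by blast

text \<open>\<open>gr\<close> forms its quotient inside \<open>C\<close> cut down to
  \<open>FC n\<close>, and the filtration of the socle lives inside the socle; both require viewing
  a submodule of \<open>M\<close> within a smaller submodule.\<close>

lemma submodule_sub_module:
  assumes N: "submodule N R M" and H: "submodule H R M" and "N \<subseteq> H"
  shows "submodule N R (M\<lparr>carrier := H\<rparr>)"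
proof -
  interpret H: module R "M\<lparr>carrier := H\<rparr>"
    by (rule submodule.submodule_is_module[OF H]) (rule module_axioms)
  interpret N: submodule N R M by fact
  have "module R (M\<lparr>carrier := H\<rparr>\<lparr>carrier := N\<rparr>)"
    using N.submodule_is_module module_axioms by simp
  then show ?thesis
    by (intro H.module_incl_imp_submodule) (use assms in auto)
qed

end

lemma (in algebra) submodule_restrict_scalars:
  assumes "module M N" "submodule H M N"
  shows "submodule H R (restrict_scalars M N)"
proof -
  interpret N: module R "restrict_scalars M N" by (rule module_restrict_scalars) fact
  interpret N': module M N by fact
  note E = N'.submoduleE[OF assms(2)]
  \<comment> \<open>Negation is not a field of the record but an inverse in the additive monoid, so
    it is identified through uniqueness of inverses.\<close>
  have "\<ominus>\<^bsub>restrict_scalars M N\<^esub> a = \<ominus>\<^bsub>N\<^esub> a" if "a \<in> H" for a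
    using that E(1,3) by (intro N.M.minus_equality) (auto simp: N'.M.l_neg)
  then show ?thesis
    using E by (intro N.submoduleI) (auto simp: N'.submodule_zero[OF assms(2)])
qed

section \<open>Dual modules and linear forms\<close>

lemma dual_simps [simp]:
  "carrier (dual K A M) = linear_forms K (restrict_scalars A M)"
  "\<zero>\<^bsub>dual K A M\<^esub> = (\<lambda>x\<in>carrier M. \<zero>\<^bsub>K\<^esub>)"
  "add (dual K A M) = (\<lambda>f g. \<lambda>x\<in>carrier M. f x \<oplus>\<^bsub>K\<^esub> g x)"
  "smult (dual K A M) = (\<lambda>a f. \<lambda>x\<in>carrier M. f (a \<odot>\<^bsub>M\<^esub> x))"
  by (simp_all add: dual_def)

lemma linear_formsD:
  assumes "f \<in> linear_forms K M"
  shows "x \<in> carrier M \<Longrightarrow> f x \<in> carrier K"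
    and "f \<in> extensional (carrier M)"
    and "\<lbrakk>x \<in> carrier M; y \<in> carrier M\<rbrakk> \<Longrightarrow> f (x \<oplus>\<^bsub>M\<^esub> y) = f x \<oplus>\<^bsub>K\<^esub> f y"
    and "\<lbrakk>r \<in> carrier K; x \<in> carrier M\<rbrakk> \<Longrightarrow> f (r \<odot>\<^bsub>M\<^esub> x) = r \<otimes>\<^bsub>K\<^esub> f x"
  using assms by (auto simp: linear_forms_def PiE_iff)

lemma linear_forms_eqI:
  assumes "f \<in> linear_forms K M" "g \<in> linear_forms K M" "\<And>x. x \<in> carrier M \<Longrightarrow> f x = g x"
  shows "f = g"
  using assms linear_formsD(2) by (metis extensionalityI)

lemma (in module) restrict_linear_formI:
  assumes "\<And>x. x \<in> carrier M \<Longrightarrow> \<phi> x \<in> carrier R"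
    and "\<And>x y. \<lbrakk>x \<in> carrier M; y \<in> carrier M\<rbrakk> \<Longrightarrow> \<phi> (x \<oplus>\<^bsub>M\<^esub> y) = \<phi> x \<oplus> \<phi> y"
    and "\<And>r x. \<lbrakk>r \<in> carrier R; x \<in> carrier M\<rbrakk> \<Longrightarrow> \<phi> (r \<odot>\<^bsub>M\<^esub> x) = r \<otimes> \<phi> x"
  shows "(\<lambda>x\<in>carrier M. \<phi> x) \<in> linear_forms R M"
  using assms by (simp add: linear_forms_def)

lemma (in algebra) module_dual:
  assumes "module M N"
  shows "module M (dual R M N)"
proof -
  interpret N: module M N by fact
  interpret V: module R "restrict_scalars M N" by (rule module_restrict_scalars) fact
  let ?L = "linear_forms R (restrict_scalars M N)"
  \<comment> \<open>Scalars act on a form through its argument, which reverses their order: both the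
    associativity of this action and the linearity of \<open>a f\<close> over \<open>R\<close> rest
    on the commutativity of \<open>M\<close>.\<close>
  have comm: "a \<odot>\<^bsub>N\<^esub> (b \<odot>\<^bsub>N\<^esub> x) = b \<odot>\<^bsub>N\<^esub> (a \<odot>\<^bsub>N\<^esub> x)"
    if "a \<in> carrier M" "b \<in> carrier M" "x \<in> carrier N" for a b x
    using that by (metis N.smult_assoc1 comm_monoid.m_comm[OF cring.axioms(2)[OF M_cring]])
  have lf: "f x \<in> carrier R" "f (x \<oplus>\<^bsub>N\<^esub> y) = f x \<oplus> f y"
    "r \<in> carrier R \<Longrightarrow> f ((r \<odot>\<^bsub>M\<^esub> \<one>\<^bsub>M\<^esub>) \<odot>\<^bsub>N\<^esub> x) = r \<otimes> f x"
    if "f \<in> ?L" "x \<in> carrier N" "y \<in> carrier N" for f x y r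
    using linear_formsD[OF that(1)] that by simp_all
  have ext: "(\<lambda>x\<in>carrier N. f x) = f" if "f \<in> ?L" for f
    using linear_formsD(2)[OF that] by (simp add: extensional_restrict)
  have eqI: "(\<lambda>x\<in>carrier N. f x) = (\<lambda>x\<in>carrier N. g x)"
    if "\<And>x. x \<in> carrier N \<Longrightarrow> f x = g x" for f g :: "'e \<Rightarrow> 'a"
    using that by (rule restrict_ext)
  note LI = V.restrict_linear_formI[simplified]
  have add: "(\<lambda>x\<in>carrier N. f x \<oplus> g x) \<in> ?L" if "f \<in> ?L" "g \<in> ?L" for f g
    using that by (intro LI) (auto simp: lf R.a_ac R.r_distr)
  have zero: "(\<lambda>x\<in>carrier N. \<zero>) \<in> ?L"
    by (intro LI) auto
  have neg: "(\<lambda>x\<in>carrier N. \<ominus> f x) \<in> ?L" if "f \<in> ?L" for f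
    using that by (intro LI) (auto simp: lf R.minus_add R.r_minus)
  have smult: "(\<lambda>x\<in>carrier N. f (a \<odot>\<^bsub>N\<^esub> x)) \<in> ?L" if "f \<in> ?L" "a \<in> carrier M" for a f
    using that by (intro LI) (auto simp: lf N.smult_r_distr comm[of a])
  show ?thesis
  proof (rule moduleI[OF M_cring])
    show "abelian_group (dual R M N)"
    proof (rule abelian_groupI)
      fix f assume f: "f \<in> carrier (dual R M N)"
      then show "\<exists>g\<in>carrier (dual R M N). g \<oplus>\<^bsub>dual R M N\<^esub> f = \<zero>\<^bsub>dual R M N\<^esub>"
        by (intro bexI[of _ "\<lambda>x\<in>carrier N. \<ominus> f x"]) (auto simp: neg lf R.l_neg intro!: eqI)
      show "\<zero>\<^bsub>dual R M N\<^esub> \<oplus>\<^bsub>dual R M N\<^esub> f = f"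
        using f by (subst (2) ext[of f, symmetric]) (auto simp: lf intro!: eqI)
    qed (auto simp: add zero lf R.a_ac intro!: eqI)
  next
    fix f assume f: "f \<in> carrier (dual R M N)"
    then show "\<one>\<^bsub>M\<^esub> \<odot>\<^bsub>dual R M N\<^esub> f = f"
      by (subst (2) ext[of f, symmetric]) (auto intro!: eqI)
  next
    fix a b f assume f: "a \<in> carrier M" "b \<in> carrier M" "f \<in> carrier (dual R M N)"
    then show "(a \<otimes>\<^bsub>M\<^esub> b) \<odot>\<^bsub>dual R M N\<^esub> f = a \<odot>\<^bsub>dual R M N\<^esub> (b \<odot>\<^bsub>dual R M N\<^esub> f)"
      by (auto simp: N.smult_assoc1 comm[of a b] intro!: eqI)
  qed (auto simp: lf N.smult_l_distr smult intro!: eqI)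
qed

text \<open>Meant for a target whose filtration is the dual of a quotient filtration: that it
  consists of submodules and is compatible with \<open>FA\<close> is carried over along
  \<open>h\<close> instead of being checked on functionals.\<close>

lemma filtered_module_iso_transport:
  assumes "filtered_module A FA M FM" "module A N" and h: "h \<in> module_iso A M N"
    and im: "\<And>n. h ` FM n = FN n" and FA: "\<And>m. FA m \<subseteq> carrier A"
  shows "filtered_module_iso A FA M FM N FN h"
proof -
  interpret M: filtered_module A FA M FM by fact
  interpret N: module A N by fact
  have hc: "h x \<in> carrier N" if "x \<in> carrier M" for x
    using h that by (auto simp: module_iso_def bij_betw_def)
  have ha: "h (x \<oplus>\<^bsub>M\<^esub> y) = h x \<oplus>\<^bsub>N\<^esub> h y" if "x \<in> carrier M" "y \<in> carrier M" for x y
    using h that by (auto simp: module_iso_def)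
  have hs: "h (a \<odot>\<^bsub>M\<^esub> x) = a \<odot>\<^bsub>N\<^esub> h x" if "a \<in> carrier A" "x \<in> carrier M" for a x
    using h that by (auto simp: module_iso_def)
  have h0: "h \<zero>\<^bsub>M\<^esub> = \<zero>\<^bsub>N\<^esub>"
    using hs[of "\<zero>\<^bsub>A\<^esub>" "\<zero>\<^bsub>M\<^esub>"] hc by simp
  have hm: "\<ominus>\<^bsub>N\<^esub> h x = h (\<ominus>\<^bsub>M\<^esub> x)" if "x \<in> carrier M" for x
    using that ha[of "\<ominus>\<^bsub>M\<^esub> x" x] h0 hc by (simp add: M.l_neg N.M.minus_equality)
  have sub: "FM n \<subseteq> carrier M" for n
    using M.submoduleE(1)[OF M.filt_submodule] .
  have FN: "submodule (FN n) A N" for n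
  proof (rule N.submoduleI)
    note E = M.submoduleE[OF M.filt_submodule[of n]]
    have ex: "\<exists>y\<in>FM n. y \<in> carrier M \<and> x = h y" if "x \<in> FN n" for x
      using that im[of n] sub[of n] by blast
    have mem: "h y \<in> FN n" if "y \<in> FM n" for y
      using that im[of n] by blast
    show "FN n \<subseteq> carrier N" using ex hc by blast
    show "\<zero>\<^bsub>N\<^esub> \<in> FN n"
      using mem[OF M.submodule_zero[OF M.filt_submodule[of n]]] h0 by simp
    show "\<ominus>\<^bsub>N\<^esub> a \<in> FN n" if "a \<in> FN n" for a
      using ex[OF that] hm mem E(3) by auto
    show "a \<oplus>\<^bsub>N\<^esub> b \<in> FN n" if "a \<in> FN n" "b \<in> FN n" for a b
      using ex[OF that(1)] ex[OF that(2)] ha[symmetric] mem E(5) by auto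
    show "a \<odot>\<^bsub>N\<^esub> x \<in> FN n" if "a \<in> carrier A" "x \<in> FN n" for a x
      using ex[OF that(2)] that(1) hs[symmetric] mem E(4) by auto
  qed
  have "filtered_module A FA N FN"
  proof (intro filtered_module.intro filtered_module_axioms.intro)
    show "FN (n + 1) \<subseteq> FN n" for n
      using M.filt_desc[of n] im by blast
    show "a \<odot>\<^bsub>N\<^esub> x \<in> FN (m + n)" if p: "a \<in> FA m" "x \<in> FN n" for a m x n
    proof -
      obtain y where y: "y \<in> FM n" "x = h y"
        using p(2) im[of n] by blast
      then have "a \<odot>\<^bsub>N\<^esub> x = h (a \<odot>\<^bsub>M\<^esub> y)"
        using hs p(1) FA sub by (metis subset_iff)
      then show ?thesis
        using M.filt_smult[OF p(1) y(1)] im[of "m + n"] by blast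
    qed
  qed (rule FN N.module_axioms)+
  then show ?thesis
    using assms by (simp add: filtered_module_iso_def)
qed

section \<open>Maps of finite rank\<close>

text \<open>A linear form on \<open>H / N\<close>, written on representatives. Unlike in
  \<open>linear_forms\<close>, values outside \<open>H\<close> are left free, so that forms can be
  pulled back along maps without restricting them.\<close>

definition form_on ::
  "('a, 'r) ring_scheme \<Rightarrow> ('a, 'b, 'm) module_scheme \<Rightarrow> 'b set \<Rightarrow> 'b set \<Rightarrow> ('b \<Rightarrow> 'a) \<Rightarrow> bool"
  where "form_on R M H N \<phi> \<longleftrightarrow>
    (\<forall>x\<in>H. \<phi> x \<in> carrier R) \<and>
    (\<forall>x\<in>H. \<forall>y\<in>H. \<phi> (x \<oplus>\<^bsub>M\<^esub> y) = \<phi> x \<oplus>\<^bsub>R\<^esub> \<phi> y) \<and>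
    (\<forall>r\<in>carrier R. \<forall>x\<in>H. \<phi> (r \<odot>\<^bsub>M\<^esub> x) = r \<otimes>\<^bsub>R\<^esub> \<phi> x) \<and>
    (\<forall>x\<in>N. \<phi> x = \<zero>\<^bsub>R\<^esub>)"

text \<open>The maps that come from the tensor product of the dual of \<open>H / N\<close> with
  \<open>H\<close>. The inductive form lets properties be proved by adding one term at a time, and
  both rules look at \<open>u\<close> on \<open>H\<close> only, so the predicate respects equality
  on \<open>H\<close>.\<close>

inductive finite_rank ::
  "('a, 'r) ring_scheme \<Rightarrow> ('a, 'b, 'm) module_scheme \<Rightarrow> 'b set \<Rightarrow> 'b set \<Rightarrow> ('b \<Rightarrow> 'b) \<Rightarrow> bool"
  for R :: "('a, 'r) ring_scheme" and M :: "('a, 'b, 'm) module_scheme" and H N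
  where
    zero: "(\<And>x. x \<in> H \<Longrightarrow> u x = \<zero>\<^bsub>M\<^esub>) \<Longrightarrow> finite_rank R M H N u"
  | step: "\<lbrakk>finite_rank R M H N v; form_on R M H N \<phi>; m \<in> H;
      \<And>x. x \<in> H \<Longrightarrow> u x = v x \<oplus>\<^bsub>M\<^esub> \<phi> x \<odot>\<^bsub>M\<^esub> m\<rbrakk> \<Longrightarrow> finite_rank R M H N u"

text \<open>
  The quotient \<open>H / N\<close> is finitely generated projective: its identity lifts to a map of finite
  rank on \<open>H\<close> which vanishes on \<open>N\<close>.
\<close>

definition splits ::
  "('a, 'r) ring_scheme \<Rightarrow> ('a, 'b, 'm) module_scheme \<Rightarrow> 'b set \<Rightarrow> 'b set \<Rightarrow> bool"
  where "splits R M H N \<longleftrightarrow> (\<exists>u. finite_rank R M H N u \<and> (\<forall>x\<in>H. x \<ominus>\<^bsub>M\<^esub> u x \<in> N))"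

lemma form_onD:
  assumes "form_on R M H N \<phi>"
  shows "x \<in> H \<Longrightarrow> \<phi> x \<in> carrier R"
    and "\<lbrakk>x \<in> H; y \<in> H\<rbrakk> \<Longrightarrow> \<phi> (x \<oplus>\<^bsub>M\<^esub> y) = \<phi> x \<oplus>\<^bsub>R\<^esub> \<phi> y"
    and "\<lbrakk>r \<in> carrier R; x \<in> H\<rbrakk> \<Longrightarrow> \<phi> (r \<odot>\<^bsub>M\<^esub> x) = r \<otimes>\<^bsub>R\<^esub> \<phi> x"
    and "x \<in> N \<Longrightarrow> \<phi> x = \<zero>\<^bsub>R\<^esub>"
  using assms unfolding form_on_def by blast+

lemma finite_rank_cong:
  assumes "finite_rank R M H N u" "\<And>x. x \<in> H \<Longrightarrow> v x = u x"
  shows "finite_rank R M H N v"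
  using assms(1)
proof cases
  case zero then show ?thesis using assms(2) by (simp add: finite_rank.zero)
next
  case (step w \<phi> m) 
  show ?thesis
    by (rule finite_rank.step[OF step(1-3)]) (simp add: step(4) assms(2))
qed

context module
begin

lemma finite_rank_closed:
  assumes "finite_rank R M H N u" and H: "submodule H R M" and x: "x \<in> H"
  shows "u x \<in> H"
  using assms(1)
proof induction
  case (zero u) then show ?case using submodule_zero[OF H] x by simp
next
  case (step v \<phi> m u)
  have "\<phi> x \<odot>\<^bsub>M\<^esub> m \<in> H"
    using submoduleE(4)[OF H form_onD(1)[OF step(2) x] step(3)] .
  then show ?case using step(4)[OF x] submoduleE(5)[OF H step.IH] by simp
qed

lemma finite_rank_add_hom:
  assumes "finite_rank R M H N u" and H: "submodule H R M" and x: "x \<in> H" "y \<in> H"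
  shows "u (x \<oplus>\<^bsub>M\<^esub> y) = u x \<oplus>\<^bsub>M\<^esub> u y"
  using assms(1)
proof induction
  case (zero u) then show ?case using submoduleE(5)[OF H x] x by simp
next
  case (step v \<phi> m u)
  note E = submoduleE(1)[OF H, THEN subsetD]
  have c: "v x \<in> carrier M" "v y \<in> carrier M" "m \<in> carrier M" "\<phi> x \<in> carrier R" "\<phi> y \<in> carrier R"
    using step x E finite_rank_closed[OF step(1) H] form_onD(1) by auto
  then have d: "\<phi> x \<odot>\<^bsub>M\<^esub> m \<in> carrier M" "\<phi> y \<odot>\<^bsub>M\<^esub> m \<in> carrier M" by auto
  have "u (x \<oplus>\<^bsub>M\<^esub> y) = (v x \<oplus>\<^bsub>M\<^esub> v y) \<oplus>\<^bsub>M\<^esub> (\<phi> x \<odot>\<^bsub>M\<^esub> m \<oplus>\<^bsub>M\<^esub> \<phi> y \<odot>\<^bsub>M\<^esub> m)"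
    using step.hyps(4) submoduleE(5)[OF H x] step.IH form_onD(2)[OF step.hyps(2) x] c
    by (simp add: smult_l_distr)
  also have "\<dots> = u x \<oplus>\<^bsub>M\<^esub> u y"
    using step.hyps(4) x c d by (simp add: M.a_ac)
  finally show ?case .
qed

lemma finite_rank_smult_hom:
  assumes "finite_rank R M H N u" and H: "submodule H R M" and x: "x \<in> H" and r: "r \<in> carrier R"
  shows "u (r \<odot>\<^bsub>M\<^esub> x) = r \<odot>\<^bsub>M\<^esub> u x"
  using assms(1)
proof induction
  case (zero u) then show ?case using submoduleE(4)[OF H r x] x r by simp
next
  case (step v \<phi> m u)
  note E = submoduleE(1)[OF H, THEN subsetD]
  have c: "v x \<in> carrier M" "m \<in> carrier M" "\<phi> x \<in> carrier R"
    using step x E finite_rank_closed[OF step(1) H] form_onD(1) by auto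
  then show ?case
    using step.hyps(4) submoduleE(4)[OF H r x] step.IH form_onD(3)[OF step.hyps(2) r x] r x
    by (simp add: smult_r_distr smult_assoc1)
qed

lemma finite_rank_vanish:
  assumes "finite_rank R M H N u" and H: "submodule H R M" "N \<subseteq> H" and x: "x \<in> N"
  shows "u x = \<zero>\<^bsub>M\<^esub>"
  using assms(1)
proof induction
  case (step v \<phi> m u)
  moreover have "m \<in> carrier M" using step(3) submoduleE(1)[OF H(1)] by blast
  ultimately show ?case
    using x subsetD[OF H(2) x] by (simp add: form_onD(4)[OF step.hyps(2)])
qed (use x H in blast)

lemma finite_rank_add:
  assumes "finite_rank R M H N u" "finite_rank R M H N v" and H: "submodule H R M"
  shows "finite_rank R M H N (\<lambda>x. v x \<oplus>\<^bsub>M\<^esub> u x)"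
  using assms(1)
proof induction
  case (zero u)
  show ?case
  proof (rule finite_rank_cong[OF assms(2)])
    show "v x \<oplus>\<^bsub>M\<^esub> u x = v x" if "x \<in> H" for x
      using zero[OF that] finite_rank_closed[OF assms(2) H that] submoduleE(1)[OF H] by (simp add: subsetD)
  qed
next
  case (step w \<phi> m u)
  show ?case
  proof (rule finite_rank.step[OF step.IH step.hyps(2,3)])
    fix x assume x: "x \<in> H"
    have "v x \<in> carrier M" "w x \<in> carrier M" "m \<in> carrier M"
      using finite_rank_closed[OF assms(2) H x] finite_rank_closed[OF step(1) H x] step(3)
      by (simp_all add: subsetD[OF submoduleE(1)[OF H]])
    moreover have "\<phi> x \<odot>\<^bsub>M\<^esub> m \<in> carrier M"
      using form_onD(1)[OF step(2) x] \<open>m \<in> carrier M\<close> by simp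
    ultimately show "v x \<oplus>\<^bsub>M\<^esub> u x = v x \<oplus>\<^bsub>M\<^esub> w x \<oplus>\<^bsub>M\<^esub> \<phi> x \<odot>\<^bsub>M\<^esub> m"
      using step(4)[OF x] by (simp add: M.a_assoc)
  qed
qed

lemma finite_rank_scale:
  assumes "finite_rank R M H N u" and H: "submodule H R M" and r: "r \<in> carrier R"
  shows "finite_rank R M H N (\<lambda>x. r \<odot>\<^bsub>M\<^esub> u x)"
  using assms(1)
proof induction
  case (zero u) then show ?case using r by (intro finite_rank.zero) simp
next
  case (step v \<phi> m u)
  show ?case
  proof (rule finite_rank.step[OF step.IH step.hyps(2)])
    show "r \<odot>\<^bsub>M\<^esub> m \<in> H" using submoduleE(4)[OF H r] step(3) .
    fix x assume x: "x \<in> H"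
    have c: "v x \<in> carrier M" "\<phi> x \<in> carrier R" "m \<in> carrier M"
      using x step finite_rank_closed[OF step(1) H] submoduleE(1)[OF H] form_onD(1)[OF step(2)] by auto
    then have "r \<odot>\<^bsub>M\<^esub> (\<phi> x \<odot>\<^bsub>M\<^esub> m) = \<phi> x \<odot>\<^bsub>M\<^esub> (r \<odot>\<^bsub>M\<^esub> m)"
      using r by (metis R.m_comm smult_assoc1)
    then show "r \<odot>\<^bsub>M\<^esub> u x = r \<odot>\<^bsub>M\<^esub> v x \<oplus>\<^bsub>M\<^esub> \<phi> x \<odot>\<^bsub>M\<^esub> (r \<odot>\<^bsub>M\<^esub> m)"
      using step(4)[OF x] r c by (simp add: smult_r_distr)
  qed
qed

lemma finite_rank_finsum:
  fixes n :: nat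
  assumes H: "submodule H R M"
    and "\<And>i. i < n \<Longrightarrow> form_on R M H N (\<phi> i)" "\<And>i. i < n \<Longrightarrow> m i \<in> H"
  shows "finite_rank R M H N (\<lambda>x. \<Oplus>\<^bsub>M\<^esub>i\<in>{..<n}. \<phi> i x \<odot>\<^bsub>M\<^esub> m i)"
  using assms(2,3)
proof (induction n)
  case 0 show ?case by (rule finite_rank.zero) simp
next
  case (Suc n)
  have IH: "finite_rank R M H N (\<lambda>x. \<Oplus>\<^bsub>M\<^esub>i\<in>{..<n}. \<phi> i x \<odot>\<^bsub>M\<^esub> m i)"
    using Suc by simp
  show ?case
  proof (rule finite_rank.step[OF IH])
    show "form_on R M H N (\<phi> n)" "m n \<in> H" using Suc.prems by simp_all
    fix x assume x: "x \<in> H"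
    have c: "\<phi> i x \<odot>\<^bsub>M\<^esub> m i \<in> carrier M" if "i < Suc n" for i
      using form_onD(1)[OF Suc.prems(1)[OF that] x] Suc.prems(2)[OF that] submoduleE(1)[OF H] by blast
    then show "(\<Oplus>\<^bsub>M\<^esub>i\<in>{..<Suc n}. \<phi> i x \<odot>\<^bsub>M\<^esub> m i) =
      (\<Oplus>\<^bsub>M\<^esub>i\<in>{..<n}. \<phi> i x \<odot>\<^bsub>M\<^esub> m i) \<oplus>\<^bsub>M\<^esub> \<phi> n x \<odot>\<^bsub>M\<^esub> m n"
      unfolding lessThan_Suc by (subst M.finsum_insert) (auto simp: M.a_comm intro!: M.finsum_closed)
  qed
qed

text \<open>Precomposition with \<open>\<rho>\<close> pulls the forms back from \<open>H'\<close> to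
  \<open>H\<close> and leaves the vectors alone, which lie in \<open>H\<close> because
  \<open>H' \<subseteq> H\<close>.\<close>

lemma finite_rank_comp:
  assumes "finite_rank R M H' N' v" and "H' \<subseteq> H" "\<rho> ` H \<subseteq> H'" "\<rho> ` N \<subseteq> N'"
    and add: "\<And>x y. \<lbrakk>x \<in> H; y \<in> H\<rbrakk> \<Longrightarrow> \<rho> (x \<oplus>\<^bsub>M\<^esub> y) = \<rho> x \<oplus>\<^bsub>M\<^esub> \<rho> y"
    and smult: "\<And>r x. \<lbrakk>r \<in> carrier R; x \<in> H\<rbrakk> \<Longrightarrow> \<rho> (r \<odot>\<^bsub>M\<^esub> x) = r \<odot>\<^bsub>M\<^esub> \<rho> x"
  shows "finite_rank R M H N (\<lambda>x. v (\<rho> x))"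
  using assms(1)
proof induction
  case (zero u) then show ?case using assms(3) by (intro finite_rank.zero) auto
next
  case (step v \<phi> m u)
  have "form_on R M H N (\<lambda>x. \<phi> (\<rho> x))"
  proof -
    have "\<rho> x \<in> H'" if "x \<in> H" for x using that assms(3) by blast
    moreover have "\<rho> x \<in> N'" if "x \<in> N" for x using that assms(4) by blast
    ultimately show ?thesis
      unfolding form_on_def by (simp add: add smult form_onD[OF step(2)])
  qed
  then show ?case
  proof (rule finite_rank.step[OF step.IH])
    show "m \<in> H" using step(3) assms(2) by blast
    show "u (\<rho> x) = v (\<rho> x) \<oplus>\<^bsub>M\<^esub> \<phi> (\<rho> x) \<odot>\<^bsub>M\<^esub> m" if "x \<in> H" for x
      using step(4) assms(3) that by blast
  qed
qed

lemma finite_rank_mono: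
  assumes "finite_rank R M H N' u" "N \<subseteq> N'"
  shows "finite_rank R M H N u"
  using finite_rank_comp[OF assms(1), of H "\<lambda>x. x" N] assms(2) by simp

section \<open>Composing and lifting splittings\<close>

lemma submodule_minus: "\<lbrakk>submodule H R M; x \<in> H; y \<in> H\<rbrakk> \<Longrightarrow> x \<ominus>\<^bsub>M\<^esub> y \<in> H"
  by (simp add: a_minus_def submoduleE(3,5))

lemma minus_eq_zeroD:
  "\<lbrakk>x \<ominus>\<^bsub>M\<^esub> y = \<zero>\<^bsub>M\<^esub>; x \<in> carrier M; y \<in> carrier M\<rbrakk> \<Longrightarrow> y = x"
  using M.minus_equality[of x "\<ominus>\<^bsub>M\<^esub> y"] by (simp add: a_minus_def)

lemma splits_refl:
  assumes "submodule H R M"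
  shows "splits R M H H"
proof -
  have "finite_rank R M H H (\<lambda>_. \<zero>\<^bsub>M\<^esub>)" by (rule finite_rank.zero) simp
  moreover have "x \<ominus>\<^bsub>M\<^esub> \<zero>\<^bsub>M\<^esub> \<in> H" if "x \<in> H" for x
    using submodule_minus[OF assms that submodule_zero[OF assms]] .
  ultimately show ?thesis unfolding splits_def by blast
qed

text \<open>Forms on \<open>H'\<close> need not extend to \<open>H\<close>, but they can be composed
  with \<open>1 - u\<close>, which maps \<open>H\<close> to \<open>H'\<close> and is the identity on
  \<open>N\<close> because \<open>u\<close> vanishes on \<open>H'\<close>. The new map is
  \<open>w = u + v (1 - u)\<close>, chosen so that \<open>1 - w = (1 - v) (1 - u)\<close>, which
  carries \<open>H\<close> first to \<open>H'\<close> and then to \<open>N\<close>.\<close>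

lemma splits_trans:
  assumes "splits R M H H'" "splits R M H' N"
    and H: "submodule H R M" and H': "submodule H' R M"
    and sub: "H' \<subseteq> H" "N \<subseteq> H'"
  shows "splits R M H N"
proof -
  obtain u v where u: "finite_rank R M H H' u" "\<And>x. x \<in> H \<Longrightarrow> x \<ominus>\<^bsub>M\<^esub> u x \<in> H'"
    and v: "finite_rank R M H' N v" "\<And>x. x \<in> H' \<Longrightarrow> x \<ominus>\<^bsub>M\<^esub> v x \<in> N"
    using assms(1,2) unfolding splits_def by blast
  let ?\<rho> = "\<lambda>x. x \<ominus>\<^bsub>M\<^esub> u x"
  note Hc = submoduleE(1)[OF H, THEN subsetD]
  have uc: "u x \<in> carrier M" if "x \<in> H" for x
    using finite_rank_closed[OF u(1) H that] Hc by blast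
  have "finite_rank R M H N (\<lambda>x. v (?\<rho> x))"
  proof (rule finite_rank_comp[OF v(1) sub(1)])
    show "?\<rho> ` H \<subseteq> H'" using u(2) by blast
    have "?\<rho> x = x" if "x \<in> N" for x
      using finite_rank_vanish[OF u(1) H sub(1)] that sub Hc by (simp add: subset_iff a_minus_def)
    then show "?\<rho> ` N \<subseteq> N" by auto
    show "?\<rho> (x \<oplus>\<^bsub>M\<^esub> y) = ?\<rho> x \<oplus>\<^bsub>M\<^esub> ?\<rho> y" if xy: "x \<in> H" "y \<in> H" for x y
      using finite_rank_add_hom[OF u(1) H xy] Hc uc xy by (simp add: a_minus_def M.minus_add M.a_ac)
    show "?\<rho> (r \<odot>\<^bsub>M\<^esub> x) = r \<odot>\<^bsub>M\<^esub> ?\<rho> x" if "r \<in> carrier R" "x \<in> H" for r x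
      using finite_rank_smult_hom[OF u(1) H that(2,1)] Hc uc that
      by (simp add: a_minus_def smult_r_distr smult_r_minus)
  qed
  then have "finite_rank R M H N (\<lambda>x. u x \<oplus>\<^bsub>M\<^esub> v (?\<rho> x))"
    using finite_rank_mono[OF u(1) sub(2)] H by (rule finite_rank_add)
  moreover have "x \<ominus>\<^bsub>M\<^esub> (u x \<oplus>\<^bsub>M\<^esub> v (?\<rho> x)) \<in> N" if x: "x \<in> H" for x
  proof -
    have "v (?\<rho> x) \<in> carrier M"
      using finite_rank_closed[OF v(1) H'] u(2)[OF x] submoduleE(1)[OF H'] by blast
    then have "x \<ominus>\<^bsub>M\<^esub> (u x \<oplus>\<^bsub>M\<^esub> v (?\<rho> x)) = ?\<rho> x \<ominus>\<^bsub>M\<^esub> v (?\<rho> x)"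
      using x Hc uc by (simp add: a_minus_def M.minus_add M.a_assoc)
    then show ?thesis using v(2) u(2) x by simp
  qed
  ultimately show ?thesis unfolding splits_def by blast
qed

text \<open>\<open>Q\<close> plays the role of \<open>H / N\<close>. The forms on \<open>Q\<close>
  are pulled back along \<open>\<pi>\<close> and each of the finitely many vectors is replaced by a
  preimage; the resulting map agrees with the identity modulo the kernel \<open>N\<close> of
  \<open>\<pi>\<close>.\<close>

lemma splits_lift:
  assumes "module R Q" and Q: "splits R Q (carrier Q) {\<zero>\<^bsub>Q\<^esub>}"
    and H: "submodule H R M"
    and onto: "\<pi> ` H = carrier Q" and ker: "\<And>x. x \<in> H \<Longrightarrow> \<pi> x = \<zero>\<^bsub>Q\<^esub> \<longleftrightarrow> x \<in> N" and "N \<subseteq> H"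
    and add: "\<And>x y. \<lbrakk>x \<in> H; y \<in> H\<rbrakk> \<Longrightarrow> \<pi> (x \<oplus>\<^bsub>M\<^esub> y) = \<pi> x \<oplus>\<^bsub>Q\<^esub> \<pi> y"
    and smult: "\<And>r x. \<lbrakk>r \<in> carrier R; x \<in> H\<rbrakk> \<Longrightarrow> \<pi> (r \<odot>\<^bsub>M\<^esub> x) = r \<odot>\<^bsub>Q\<^esub> \<pi> x"
  shows "splits R M H N"
proof -
  interpret Q: module R Q by fact
  have \<pi>c: "\<pi> x \<in> carrier Q" if "x \<in> H" for x using onto that by blast
  note H0 = submodule_zero[OF H]
  have \<pi>0: "\<pi> \<zero>\<^bsub>M\<^esub> = \<zero>\<^bsub>Q\<^esub>"
    using smult[OF R.zero_closed H0] \<pi>c[OF H0] by simp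
  obtain u where u: "finite_rank R Q (carrier Q) {\<zero>\<^bsub>Q\<^esub>} u"
    and u1: "\<And>x. x \<in> carrier Q \<Longrightarrow> x \<ominus>\<^bsub>Q\<^esub> u x = \<zero>\<^bsub>Q\<^esub>"
    using Q unfolding splits_def by blast
  have uc: "u x \<in> carrier Q" if "x \<in> carrier Q" for x
    using Q.finite_rank_closed[OF u Q.carrier_is_submodule that] .
  have u_id: "u x = x" if "x \<in> carrier Q" for x
    using u1[OF that] uc[OF that] that by (simp add: Q.minus_eq_zeroD)
  \<comment> \<open>Claimed for every map of finite rank on \<open>Q\<close>, since the partial sums
    met in the induction are not the identity.\<close>
  have "\<exists>v. finite_rank R M H N v \<and> (\<forall>x\<in>H. \<pi> (v x) = u (\<pi> x))"
    using u
  proof induction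
    case (zero u)
    then show ?case
      by (intro exI[of _ "\<lambda>_. \<zero>\<^bsub>M\<^esub>"]) (auto simp: \<pi>0 \<pi>c intro: finite_rank.zero)
  next
    case (step w \<phi> m u)
    then obtain v where v: "finite_rank R M H N v" "\<forall>x\<in>H. \<pi> (v x) = w (\<pi> x)" by blast
    obtain m' where m': "m' \<in> H" "m = \<pi> m'" using onto step(3) by blast
    have f: "form_on R M H N (\<lambda>x. \<phi> (\<pi> x))"
    proof -
      have "\<pi> x = \<zero>\<^bsub>Q\<^esub>" if "x \<in> N" for x using ker that \<open>N \<subseteq> H\<close> by blast
      then show ?thesis
        unfolding form_on_def by (simp add: add smult \<pi>c form_onD[OF step(2)])
    qed
    have "finite_rank R M H N (\<lambda>x. v x \<oplus>\<^bsub>M\<^esub> \<phi> (\<pi> x) \<odot>\<^bsub>M\<^esub> m')"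
      by (rule finite_rank.step[OF v(1) f m'(1)]) simp
    moreover have "\<pi> (v x \<oplus>\<^bsub>M\<^esub> \<phi> (\<pi> x) \<odot>\<^bsub>M\<^esub> m') = u (\<pi> x)" if x: "x \<in> H" for x
    proof -
      have "\<phi> (\<pi> x) \<in> carrier R" using form_onD(1)[OF f x] .
      moreover have "v x \<in> H" using finite_rank_closed[OF v(1) H x] .
      ultimately show ?thesis
        using step(4)[OF \<pi>c[OF x]] v(2) x m' submoduleE(4)[OF H _ m'(1)]
        by (simp add: add smult)
    qed
    ultimately show ?case by blast
  qed
  then obtain v where v: "finite_rank R M H N v" "\<forall>x\<in>H. \<pi> (v x) = u (\<pi> x)" by blast
  have "x \<ominus>\<^bsub>M\<^esub> v x \<in> N" if x: "x \<in> H" for x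
  proof -
    have vx: "v x \<in> H" using finite_rank_closed[OF v(1) H x] .
    have d: "x \<ominus>\<^bsub>M\<^esub> v x \<in> H" using submodule_minus[OF H x vx] .
    have "(x \<ominus>\<^bsub>M\<^esub> v x) \<oplus>\<^bsub>M\<^esub> v x = x"
      using x vx submoduleE(1)[OF H] by (simp add: a_minus_def M.a_assoc M.l_neg subset_iff)
    then have "\<pi> (x \<ominus>\<^bsub>M\<^esub> v x) \<oplus>\<^bsub>Q\<^esub> \<pi> x = \<pi> x"
      using add[OF d vx] v(2) u_id x \<pi>c by simp
    then have "\<pi> (x \<ominus>\<^bsub>M\<^esub> v x) = \<zero>\<^bsub>Q\<^esub>"
      using \<pi>c[OF x] \<pi>c[OF d] by simp
    then show ?thesis using ker[OF d] by simp
  qed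
  then show ?thesis using v(1) unfolding splits_def by blast
qed

section \<open>What a splitting says about linear forms\<close>

lemma form_on_restrict:
  assumes "form_on R M (carrier M) N \<phi>"
  shows "(\<lambda>x\<in>carrier M. \<phi> x) \<in> linear_forms R M"
  by (rule restrict_linear_formI) (simp_all add: form_onD[OF assms])

text \<open>The forms in a decomposition of \<open>u\<close> vanish on \<open>N\<close> and
  therefore at \<open>c\<close>. So \<open>u c\<close> is zero, and \<open>c = c - u c\<close> lies
  in \<open>N\<close>.\<close>

lemma splits_torsionless:
  assumes "splits R M (carrier M) N" "N \<subseteq> carrier M" and c: "c \<in> carrier M"
    and van: "\<And>f. \<lbrakk>f \<in> linear_forms R M; \<And>x. x \<in> N \<Longrightarrow> f x = \<zero>\<rbrakk> \<Longrightarrow> f c = \<zero>"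
  shows "c \<in> N"
proof -
  obtain u where u: "finite_rank R M (carrier M) N u" "c \<ominus>\<^bsub>M\<^esub> u c \<in> N"
    using assms(1) c unfolding splits_def by blast
  have "u c = \<zero>\<^bsub>M\<^esub>"
    using u(1)
  proof induction
    case (step v \<phi> m u)
    have "(\<lambda>x\<in>carrier M. \<phi> x) c = \<zero>"
      by (rule van[OF form_on_restrict[OF step(2)]]) (use form_onD(4)[OF step(2)] assms(2) in auto)
    then show ?case using step c by simp
  qed (use c in auto)
  moreover have "c \<ominus>\<^bsub>M\<^esub> \<zero>\<^bsub>M\<^esub> = c"
    using M.minus_equality[of "\<zero>\<^bsub>M\<^esub>" "\<zero>\<^bsub>M\<^esub>"] c unfolding a_minus_def by (metis M.r_zero M.zero_closed)
  ultimately show ?thesis using u(2) by simp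
qed

text \<open>If the identity is the sum of the maps \<open>x \<mapsto> \<phi>_i x m_i\<close>, then
  every form \<open>f\<close> is the sum of the \<open>f(m_i) \<phi>_i\<close>. Applying
  \<open>\<Psi>\<close> shows that \<open>\<Psi> f\<close> is the value of \<open>f\<close> at the
  sum of the \<open>\<Psi>(\<phi>_i) m_i\<close>, which is the required \<open>c\<close>.\<close>

lemma splits_reflexive:
  assumes "splits R M (carrier M) {\<zero>\<^bsub>M\<^esub>}"
    and \<Psi>c: "\<And>f. f \<in> linear_forms R M \<Longrightarrow> \<Psi> f \<in> carrier R"
    and \<Psi>a: "\<And>f g. \<lbrakk>f \<in> linear_forms R M; g \<in> linear_forms R M\<rbrakk>
      \<Longrightarrow> \<Psi> (\<lambda>x\<in>carrier M. f x \<oplus> g x) = \<Psi> f \<oplus> \<Psi> g"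
    and \<Psi>s: "\<And>r f. \<lbrakk>r \<in> carrier R; f \<in> linear_forms R M\<rbrakk>
      \<Longrightarrow> \<Psi> (\<lambda>x\<in>carrier M. r \<otimes> f x) = r \<otimes> \<Psi> f"
  shows "\<exists>c\<in>carrier M. \<forall>f\<in>linear_forms R M. \<Psi> f = f c"
proof -
  obtain u where u: "finite_rank R M (carrier M) {\<zero>\<^bsub>M\<^esub>} u"
    and u1: "\<And>x. x \<in> carrier M \<Longrightarrow> x \<ominus>\<^bsub>M\<^esub> u x = \<zero>\<^bsub>M\<^esub>"
    using assms(1) unfolding splits_def by blast
  note closed = finite_rank_closed[OF _ carrier_is_submodule]
  have u_id: "u x = x" if "x \<in> carrier M" for x
    using u1[OF that] closed[OF u that] that by (simp add: minus_eq_zeroD)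
  have f0: "f \<zero>\<^bsub>M\<^esub> = \<zero>" if "f \<in> linear_forms R M" for f
    using linear_formsD(4)[OF that R.zero_closed M.zero_closed] linear_formsD(1)[OF that M.zero_closed]
    by simp
  \<comment> \<open>With \<open>f\<close> composed with \<open>u\<close> in place of
    \<open>f\<close>, the induction can run over the partial sums of the identity; every term adds
    its own \<open>\<Psi> ?\<phi> \<odot> m\<close> to \<open>c\<close>.\<close>
  have "\<exists>c\<in>carrier M. \<forall>f\<in>linear_forms R M. \<Psi> (\<lambda>x\<in>carrier M. f (u x)) = f c"
    using u
  proof induction
    case (zero u)
    have "\<Psi> (\<lambda>x\<in>carrier M. f (u x)) = f \<zero>\<^bsub>M\<^esub>" if f: "f \<in> linear_forms R M" for f
    proof -
      \<comment> \<open>The zero form is written as \<open>\<zero>\<close> times \<open>f\<close>,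
        so that homogeneity of \<open>\<Psi>\<close> gives it the value zero.\<close>
      have "(\<lambda>x\<in>carrier M. f (u x)) = (\<lambda>x\<in>carrier M. \<zero> \<otimes> f x)"
        by (rule restrict_ext) (use zero f0[OF f] linear_formsD(1)[OF f] in auto)
      then show ?thesis using \<Psi>s[OF R.zero_closed f] \<Psi>c[OF f] f0[OF f] by simp
    qed
    then show ?case by blast
  next
    case (step v \<phi> m u)
    then obtain c where c: "c \<in> carrier M" "\<forall>f\<in>linear_forms R M. \<Psi> (\<lambda>x\<in>carrier M. f (v x)) = f c"
      by blast
    let ?\<phi> = "\<lambda>x\<in>carrier M. \<phi> x"
    have \<phi>: "?\<phi> \<in> linear_forms R M" using form_on_restrict[OF step(2)] .
    have "\<Psi> (\<lambda>x\<in>carrier M. f (u x)) = f (c \<oplus>\<^bsub>M\<^esub> \<Psi> ?\<phi> \<odot>\<^bsub>M\<^esub> m)" if f: "f \<in> linear_forms R M" for f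
    proof -
      note lf = linear_formsD[OF f]
      let ?fv = "\<lambda>x\<in>carrier M. f (v x)" and ?m\<phi> = "\<lambda>x\<in>carrier M. f m \<otimes> ?\<phi> x"
      have fm: "f m \<in> carrier R" using lf(1) step(3) .
      have fv: "?fv \<in> linear_forms R M"
        by (rule restrict_linear_formI)
          (auto simp: closed[OF step(1)] lf finite_rank_add_hom[OF step(1) carrier_is_submodule]
            finite_rank_smult_hom[OF step(1) carrier_is_submodule])
      have m\<phi>: "?m\<phi> \<in> linear_forms R M"
        by (rule restrict_linear_formI) (use fm in \<open>auto simp: form_onD[OF step(2)] R.r_distr R.m_lcomm\<close>)
      have "(\<lambda>x\<in>carrier M. f (u x)) = (\<lambda>x\<in>carrier M. ?fv x \<oplus> ?m\<phi> x)"
        by (rule restrict_ext)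
          (use step(3,4) fm in \<open>auto simp: lf closed[OF step(1)] form_onD[OF step(2)] R.m_comm\<close>)
      then have "\<Psi> (\<lambda>x\<in>carrier M. f (u x)) = f c \<oplus> f m \<otimes> \<Psi> ?\<phi>"
        using \<Psi>a[OF fv m\<phi>] \<Psi>s[OF fm \<phi>] c(2) f by simp
      also have "\<dots> = f (c \<oplus>\<^bsub>M\<^esub> \<Psi> ?\<phi> \<odot>\<^bsub>M\<^esub> m)"
        using c(1) \<Psi>c[OF \<phi>] step(3) fm by (simp add: lf R.m_comm)
      finally show ?thesis .
    qed
    moreover have "c \<oplus>\<^bsub>M\<^esub> \<Psi> ?\<phi> \<odot>\<^bsub>M\<^esub> m \<in> carrier M" using c(1) \<Psi>c[OF \<phi>] step(3) by simp
    ultimately show ?case by blast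
  qed
  then obtain c where c: "c \<in> carrier M" "\<forall>f\<in>linear_forms R M. \<Psi> (\<lambda>x\<in>carrier M. f (u x)) = f c"
    by blast
  have "(\<lambda>x\<in>carrier M. f (u x)) = f" if "f \<in> linear_forms R M" for f
  proof -
    have "(\<lambda>x\<in>carrier M. f (u x)) = (\<lambda>x\<in>carrier M. f x)" by (rule restrict_ext) (simp add: u_id)
    also have "\<dots> = f" using linear_formsD(2)[OF that] by (simp add: extensional_restrict)
    finally show ?thesis .
  qed
  then show ?thesis using c by auto
qed

end

section \<open>Modules of fractions\<close>

lemma self_module_simps [simp]:
  "carrier (self_module R) = carrier R" "\<zero>\<^bsub>self_module R\<^esub> = \<zero>\<^bsub>R\<^esub>"
  "add (self_module R) = add R" "smult (self_module R) = mult R"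
  by (simp_all add: self_module_def)

lemma (in cring) module_self: "module R (self_module R)"
proof (rule moduleI[OF is_cring])
  show "abelian_group (self_module R)"
    by (rule abelian_groupI) (auto simp: a_ac intro: l_neg)
qed (auto simp: l_distr r_distr m_assoc)

lemma loc_module_carrier: "carrier (loc_module R S M) = (carrier M \<times> S) // loc_rel S M"
  by (simp add: loc_module_def)

text \<open>The operations of \<open>loc_module\<close> are unions over all representing pairs. Once
  the result is known not to depend on the pair, this evaluates the union.\<close>

lemma UN_const_pair:
  assumes "X \<noteq> {}" "\<And>m s. (m, s) \<in> X \<Longrightarrow> F m s = c"
  shows "(\<Union>(m, s)\<in>X. F m s) = c"
  using assms by fastforce

locale localization = module R M for R :: "('a, 'r) ring_scheme" (structure)
    and M :: "('a, 'b, 'm) module_scheme" (structure) +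
  fixes S :: "'a set"
  assumes S_sub: "S \<subseteq> carrier R" and S_one: "\<one> \<in> S"
    and S_mult: "\<lbrakk>s \<in> S; t \<in> S\<rbrakk> \<Longrightarrow> s \<otimes> t \<in> S"
begin

lemma S_carrier [simp]: "s \<in> S \<Longrightarrow> s \<in> carrier R"
  using S_sub by blast

lemma loc_rel_iff:
  "((m, s), (n, t)) \<in> loc_rel S M \<longleftrightarrow> m \<in> carrier M \<and> n \<in> carrier M \<and> s \<in> S \<and> t \<in> S \<and>
    (\<exists>u\<in>S. (u \<otimes> t) \<odot>\<^bsub>M\<^esub> m = (u \<otimes> s) \<odot>\<^bsub>M\<^esub> n)"
proof -
  have "u \<odot>\<^bsub>M\<^esub> (t \<odot>\<^bsub>M\<^esub> m) = (u \<otimes> t) \<odot>\<^bsub>M\<^esub> m" if "u \<in> S" "t \<in> S" "m \<in> carrier M" for u t m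
    using that by (simp add: smult_assoc1)
  then show ?thesis
    unfolding loc_rel_def by (simp cong: conj_cong bex_cong)
qed

lemma smult_eq_multiple:
  assumes "(u \<otimes> t) \<odot>\<^bsub>M\<^esub> m = (u \<otimes> s) \<odot>\<^bsub>M\<^esub> n" "a \<in> carrier R"
    "u \<in> S" "s \<in> S" "t \<in> S" "m \<in> carrier M" "n \<in> carrier M"
  shows "(a \<otimes> (u \<otimes> t)) \<odot>\<^bsub>M\<^esub> m = (a \<otimes> (u \<otimes> s)) \<odot>\<^bsub>M\<^esub> n"
  using assms by (simp add: smult_assoc1)

lemma equiv_loc_rel: "equiv (carrier M \<times> S) (loc_rel S M)"
proof (rule equivI)
  show "loc_rel S M \<subseteq> (carrier M \<times> S) \<times> (carrier M \<times> S)"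
    by (auto simp: loc_rel_def)
  show "refl_on (carrier M \<times> S) (loc_rel S M)"
    using S_one by (auto simp: refl_on_def loc_rel_iff)
  show "sym (loc_rel S M)"
    unfolding sym_def by (auto simp: loc_rel_iff dest: sym)
  show "trans (loc_rel S M)"
  proof (rule transI, clarify)
    fix m s n t p w
    assume "((m, s), (n, t)) \<in> loc_rel S M" "((n, t), (p, w)) \<in> loc_rel S M"
    then obtain u v where c: "m \<in> carrier M" "n \<in> carrier M" "p \<in> carrier M" "s \<in> S" "t \<in> S" "w \<in> S"
        "u \<in> S" "v \<in> S"
      and u: "(u \<otimes> t) \<odot>\<^bsub>M\<^esub> m = (u \<otimes> s) \<odot>\<^bsub>M\<^esub> n" and v: "(v \<otimes> w) \<odot>\<^bsub>M\<^esub> n = (v \<otimes> t) \<odot>\<^bsub>M\<^esub> p"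
      by (auto simp: loc_rel_iff)
    have "((v \<otimes> w) \<otimes> (u \<otimes> t)) \<odot>\<^bsub>M\<^esub> m = ((v \<otimes> w) \<otimes> (u \<otimes> s)) \<odot>\<^bsub>M\<^esub> n"
      by (rule smult_eq_multiple[OF u]) (use c in auto)
    moreover have "((u \<otimes> s) \<otimes> (v \<otimes> w)) \<odot>\<^bsub>M\<^esub> n = ((u \<otimes> s) \<otimes> (v \<otimes> t)) \<odot>\<^bsub>M\<^esub> p"
      by (rule smult_eq_multiple[OF v]) (use c in auto)
    \<comment> \<open>The middle denominator \<open>t\<close> cannot be cancelled in general, so it
      becomes part of the witness \<open>u \<otimes> v \<otimes> t\<close>.\<close>
    ultimately have "((u \<otimes> v \<otimes> t) \<otimes> w) \<odot>\<^bsub>M\<^esub> m = ((u \<otimes> v \<otimes> t) \<otimes> s) \<odot>\<^bsub>M\<^esub> p"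
      using c by (simp add: R.m_ac)
    moreover have "u \<otimes> v \<otimes> t \<in> S" using c S_mult by simp
    ultimately show "((m, s), (p, w)) \<in> loc_rel S M"
      using c unfolding loc_rel_iff by blast
  qed
qed

abbreviation frac where "frac \<equiv> loc_frac S M"
abbreviation L where "L \<equiv> loc_module R S M"

lemma frac_eq_iff:
  assumes "m \<in> carrier M" "s \<in> S" "n \<in> carrier M" "t \<in> S"
  shows "frac m s = frac n t \<longleftrightarrow> (\<exists>u\<in>S. (u \<otimes> t) \<odot>\<^bsub>M\<^esub> m = (u \<otimes> s) \<odot>\<^bsub>M\<^esub> n)"
  unfolding loc_frac_def using eq_equiv_class_iff[OF equiv_loc_rel] assms by (simp add: loc_rel_iff)

lemma frac_eqI:
  assumes "m \<in> carrier M" "s \<in> S" "n \<in> carrier M" "t \<in> S" "u \<in> S"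
    "(u \<otimes> t) \<odot>\<^bsub>M\<^esub> m = (u \<otimes> s) \<odot>\<^bsub>M\<^esub> n"
  shows "frac m s = frac n t"
  using frac_eq_iff[OF assms(1-4)] assms(5,6) by blast

lemma frac_closed [simp]: "\<lbrakk>m \<in> carrier M; s \<in> S\<rbrakk> \<Longrightarrow> frac m s \<in> carrier L"
  unfolding loc_module_carrier loc_frac_def by (simp add: quotientI)

lemma fracE:
  assumes "X \<in> carrier L"
  obtains m s where "m \<in> carrier M" "s \<in> S" "X = frac m s"
proof -
  obtain p where "p \<in> carrier M \<times> S" "X = loc_rel S M `` {p}"
    using assms unfolding loc_module_carrier by (rule quotientE)
  then show thesis
    using that[of "fst p" "snd p"] by (simp add: loc_frac_def mem_Times_iff)
qed

lemma frac_memD: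
  assumes "(m', s') \<in> frac m s" "m \<in> carrier M" "s \<in> S"
  shows "m' \<in> carrier M" "s' \<in> S" "\<exists>u\<in>S. (u \<otimes> s') \<odot>\<^bsub>M\<^esub> m = (u \<otimes> s) \<odot>\<^bsub>M\<^esub> m'"
proof -
  have "((m, s), (m', s')) \<in> loc_rel S M" using assms(1) unfolding loc_frac_def by simp
  then show "m' \<in> carrier M" "s' \<in> S" "\<exists>u\<in>S. (u \<otimes> s') \<odot>\<^bsub>M\<^esub> m = (u \<otimes> s) \<odot>\<^bsub>M\<^esub> m'"
    unfolding loc_rel_iff by blast+
qed

lemma frac_nonempty: "\<lbrakk>m \<in> carrier M; s \<in> S\<rbrakk> \<Longrightarrow> frac m s \<noteq> {}"
  unfolding loc_frac_def using equiv_class_self[OF equiv_loc_rel] by blast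

lemma L_zero: "\<zero>\<^bsub>L\<^esub> = frac \<zero>\<^bsub>M\<^esub> \<one>"
  by (simp add: loc_module_def)

lemma L_add:
  assumes c: "m \<in> carrier M" "s \<in> S" "n \<in> carrier M" "t \<in> S"
  shows "frac m s \<oplus>\<^bsub>L\<^esub> frac n t = frac (t \<odot>\<^bsub>M\<^esub> m \<oplus>\<^bsub>M\<^esub> s \<odot>\<^bsub>M\<^esub> n) (s \<otimes> t)"
proof -
  have eq: "frac (t' \<odot>\<^bsub>M\<^esub> m' \<oplus>\<^bsub>M\<^esub> s' \<odot>\<^bsub>M\<^esub> n') (s' \<otimes> t') = frac (t \<odot>\<^bsub>M\<^esub> m \<oplus>\<^bsub>M\<^esub> s \<odot>\<^bsub>M\<^esub> n) (s \<otimes> t)"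
    if m': "(m', s') \<in> frac m s" and n': "(n', t') \<in> frac n t" for m' s' n' t'
  proof -
    obtain u where u: "u \<in> S" "(u \<otimes> s') \<odot>\<^bsub>M\<^esub> m = (u \<otimes> s) \<odot>\<^bsub>M\<^esub> m'"
      using frac_memD(3)[OF m'] c by blast
    obtain v where v: "v \<in> S" "(v \<otimes> t') \<odot>\<^bsub>M\<^esub> n = (v \<otimes> t) \<odot>\<^bsub>M\<^esub> n'"
      using frac_memD(3)[OF n'] c by blast
    have c': "m' \<in> carrier M" "s' \<in> S" "n' \<in> carrier M" "t' \<in> S"
      using frac_memD(1,2)[OF m'] frac_memD(1,2)[OF n'] c by blast+
    \<comment> \<open>The factors \<open>v t t'\<close> here and \<open>u s s'\<close> below turn
      the two relations into the summands of one relation with the joint witness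
      \<open>u \<otimes> v\<close>.\<close>
    have 1: "((v \<otimes> t \<otimes> t') \<otimes> (u \<otimes> s')) \<odot>\<^bsub>M\<^esub> m = ((v \<otimes> t \<otimes> t') \<otimes> (u \<otimes> s)) \<odot>\<^bsub>M\<^esub> m'"
      by (rule smult_eq_multiple[OF u(2)]) (use c c' u v in auto)
    have 2: "((u \<otimes> s \<otimes> s') \<otimes> (v \<otimes> t')) \<odot>\<^bsub>M\<^esub> n = ((u \<otimes> s \<otimes> s') \<otimes> (v \<otimes> t)) \<odot>\<^bsub>M\<^esub> n'"
      by (rule smult_eq_multiple[OF v(2)]) (use c c' u v in auto)
    show ?thesis
    proof (rule frac_eqI[of _ _ _ _ "u \<otimes> v"])
      have "((u \<otimes> v) \<otimes> (s \<otimes> t)) \<odot>\<^bsub>M\<^esub> (t' \<odot>\<^bsub>M\<^esub> m' \<oplus>\<^bsub>M\<^esub> s' \<odot>\<^bsub>M\<^esub> n') =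
        ((v \<otimes> t \<otimes> t') \<otimes> (u \<otimes> s)) \<odot>\<^bsub>M\<^esub> m' \<oplus>\<^bsub>M\<^esub> ((u \<otimes> s \<otimes> s') \<otimes> (v \<otimes> t)) \<odot>\<^bsub>M\<^esub> n'"
        using c c' u(1) v(1) by (simp add: smult_r_distr smult_assoc1[symmetric] R.m_ac)
      also have "\<dots> = ((v \<otimes> t \<otimes> t') \<otimes> (u \<otimes> s')) \<odot>\<^bsub>M\<^esub> m \<oplus>\<^bsub>M\<^esub> ((u \<otimes> s \<otimes> s') \<otimes> (v \<otimes> t')) \<odot>\<^bsub>M\<^esub> n"
        by (simp only: 1 2)
      also have "\<dots> = ((u \<otimes> v) \<otimes> (s' \<otimes> t')) \<odot>\<^bsub>M\<^esub> (t \<odot>\<^bsub>M\<^esub> m \<oplus>\<^bsub>M\<^esub> s \<odot>\<^bsub>M\<^esub> n)"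
        using c c' u(1) v(1) by (simp add: smult_r_distr smult_assoc1[symmetric] R.m_ac)
      finally show "((u \<otimes> v) \<otimes> (s \<otimes> t)) \<odot>\<^bsub>M\<^esub> (t' \<odot>\<^bsub>M\<^esub> m' \<oplus>\<^bsub>M\<^esub> s' \<odot>\<^bsub>M\<^esub> n') =
        ((u \<otimes> v) \<otimes> (s' \<otimes> t')) \<odot>\<^bsub>M\<^esub> (t \<odot>\<^bsub>M\<^esub> m \<oplus>\<^bsub>M\<^esub> s \<odot>\<^bsub>M\<^esub> n)" .
    qed (use c c' u v S_mult in auto)
  qed
  have "(\<Union>(m', s')\<in>frac m s. \<Union>(n', t')\<in>frac n t. frac (t' \<odot>\<^bsub>M\<^esub> m' \<oplus>\<^bsub>M\<^esub> s' \<odot>\<^bsub>M\<^esub> n') (s' \<otimes> t'))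
      = frac (t \<odot>\<^bsub>M\<^esub> m \<oplus>\<^bsub>M\<^esub> s \<odot>\<^bsub>M\<^esub> n) (s \<otimes> t)"
    by (intro UN_const_pair frac_nonempty c eq)
  then show ?thesis by (simp add: loc_module_def)
qed

text \<open>The commutative monoid laws are what the finite sums in \<open>free_of_rank\<close> rest
  on.\<close>

lemma abelian_monoid_loc: "abelian_monoid L"
proof (rule abelian_monoidI)
  fix X Y Z assume "X \<in> carrier L" "Y \<in> carrier L" "Z \<in> carrier L"
  then obtain m s n t p w where c: "m \<in> carrier M" "s \<in> S" "n \<in> carrier M" "t \<in> S" "p \<in> carrier M" "w \<in> S"
    and X: "X = frac m s" "Y = frac n t" "Z = frac p w" by (metis fracE)
  have d: "s \<otimes> t \<in> S" "t \<otimes> w \<in> S" using c S_mult by auto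
  show "X \<oplus>\<^bsub>L\<^esub> Y \<oplus>\<^bsub>L\<^esub> Z = X \<oplus>\<^bsub>L\<^esub> (Y \<oplus>\<^bsub>L\<^esub> Z)"
    using c d by (simp add: X L_add smult_r_distr smult_assoc1[symmetric] R.m_ac M.a_assoc)
next
  fix X Y assume "X \<in> carrier L" "Y \<in> carrier L"
  then obtain m s n t where c: "m \<in> carrier M" "s \<in> S" "n \<in> carrier M" "t \<in> S"
    and X: "X = frac m s" "Y = frac n t" by (metis fracE)
  show "X \<oplus>\<^bsub>L\<^esub> Y \<in> carrier L" using c S_mult by (simp add: X L_add)
  show "X \<oplus>\<^bsub>L\<^esub> Y = Y \<oplus>\<^bsub>L\<^esub> X" using c by (simp add: X L_add R.m_comm M.a_comm)
  show "\<zero>\<^bsub>L\<^esub> \<oplus>\<^bsub>L\<^esub> X = X" using c S_one by (simp add: X L_add L_zero)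
qed (simp add: L_zero S_one)

text \<open>The ring of fractions is the module of fractions of \<open>R\<close> over itself, so
  that facts about \<open>frac\<close> also hold for \<open>sfrac\<close>.\<close>

lemma localization_self: "localization R (self_module R) S"
  by (intro localization.intro module_self localization_axioms.intro S_sub S_one S_mult)

abbreviation sfrac where "sfrac \<equiv> loc_frac S (self_module R)"

lemma carrier_loc_ring: "carrier (loc_ring R S) = carrier (loc_module R S (self_module R))"
  by (simp add: loc_ring_def Let_def)

lemma sfracE:
  assumes "X \<in> carrier (loc_ring R S)"
  obtains a s where "a \<in> carrier R" "s \<in> S" "X = sfrac a s"
  using localization.fracE[OF localization_self assms[unfolded carrier_loc_ring]] by auto

lemma sfrac_closed: "\<lbrakk>a \<in> carrier R; s \<in> S\<rbrakk> \<Longrightarrow> sfrac a s \<in> carrier (loc_ring R S)"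
  using localization.frac_closed[OF localization_self] by (simp add: carrier_loc_ring)

lemma sfrac_eqD:
  assumes "sfrac a s = sfrac b t" "a \<in> carrier R" "s \<in> S" "b \<in> carrier R" "t \<in> S"
  shows "\<exists>u\<in>S. u \<otimes> t \<otimes> a = u \<otimes> s \<otimes> b"
  using localization.frac_eq_iff[OF localization_self, of a s b t] assms by simp

lemma L_smult:
  assumes c: "a \<in> carrier R" "s \<in> S" "n \<in> carrier M" "t \<in> S"
  shows "sfrac a s \<odot>\<^bsub>L\<^esub> frac n t = frac (a \<odot>\<^bsub>M\<^esub> n) (s \<otimes> t)"
proof -
  interpret self: localization R "self_module R" S by (rule localization_self)
  have eq: "frac (a' \<odot>\<^bsub>M\<^esub> n') (s' \<otimes> t') = frac (a \<odot>\<^bsub>M\<^esub> n) (s \<otimes> t)"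
    if a': "(a', s') \<in> sfrac a s" and n': "(n', t') \<in> frac n t" for a' s' n' t'
  proof -
    obtain u where u: "u \<in> S" "u \<otimes> s' \<otimes> a = u \<otimes> s \<otimes> a'"
      using self.frac_memD(3)[OF a'] c by auto
    obtain v where v: "v \<in> S" "(v \<otimes> t') \<odot>\<^bsub>M\<^esub> n = (v \<otimes> t) \<odot>\<^bsub>M\<^esub> n'"
      using frac_memD(3)[OF n'] c by blast
    have c': "a' \<in> carrier R" "s' \<in> S" "n' \<in> carrier M" "t' \<in> S"
      using self.frac_memD(1,2)[OF a'] frac_memD(1,2)[OF n'] c by auto
    show ?thesis
    proof (rule frac_eqI[of _ _ _ _ "u \<otimes> v"])
      have "((u \<otimes> v) \<otimes> (s \<otimes> t)) \<odot>\<^bsub>M\<^esub> (a' \<odot>\<^bsub>M\<^esub> n') = (u \<otimes> s \<otimes> a') \<odot>\<^bsub>M\<^esub> ((v \<otimes> t) \<odot>\<^bsub>M\<^esub> n')"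
        using c c' u(1) v(1) by (simp add: smult_assoc1[symmetric] R.m_ac)
      also have "\<dots> = (u \<otimes> s' \<otimes> a) \<odot>\<^bsub>M\<^esub> ((v \<otimes> t') \<odot>\<^bsub>M\<^esub> n)"
        by (simp only: u(2) v(2))
      also have "\<dots> = ((u \<otimes> v) \<otimes> (s' \<otimes> t')) \<odot>\<^bsub>M\<^esub> (a \<odot>\<^bsub>M\<^esub> n)"
        using c c' u(1) v(1) by (simp add: smult_assoc1[symmetric] R.m_ac)
      finally show "((u \<otimes> v) \<otimes> (s \<otimes> t)) \<odot>\<^bsub>M\<^esub> (a' \<odot>\<^bsub>M\<^esub> n') = ((u \<otimes> v) \<otimes> (s' \<otimes> t')) \<odot>\<^bsub>M\<^esub> (a \<odot>\<^bsub>M\<^esub> n)" .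
    qed (use c c' u v S_mult in auto)
  qed
  have "(\<Union>(a', s')\<in>sfrac a s. \<Union>(n', t')\<in>frac n t. frac (a' \<odot>\<^bsub>M\<^esub> n') (s' \<otimes> t')) = frac (a \<odot>\<^bsub>M\<^esub> n) (s \<otimes> t)"
    using c by (intro UN_const_pair frac_nonempty self.frac_nonempty eq) auto
  then show ?thesis by (simp add: loc_module_def)
qed

end

section \<open>Linear combinations and bases of modules of fractions\<close>

definition (in module) lincomb :: "(nat \<Rightarrow> 'c) \<Rightarrow> (nat \<Rightarrow> 'a) \<Rightarrow> nat \<Rightarrow> 'c" where
  "lincomb m q n = (\<Oplus>\<^bsub>M\<^esub>i\<in>{..<n}. q i \<odot>\<^bsub>M\<^esub> m i)"

context module
begin

lemma lincomb_0 [simp]: "lincomb m q 0 = \<zero>\<^bsub>M\<^esub>"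
  by (simp add: lincomb_def)

lemma lincomb_closed:
  "\<lbrakk>\<And>i. i < n \<Longrightarrow> m i \<in> carrier M; \<And>i. i < n \<Longrightarrow> q i \<in> carrier R\<rbrakk> \<Longrightarrow> lincomb m q n \<in> carrier M"
  unfolding lincomb_def by (rule M.finsum_closed) auto

lemma lincomb_Suc:
  assumes "\<And>i. i < Suc n \<Longrightarrow> m i \<in> carrier M" "\<And>i. i < Suc n \<Longrightarrow> q i \<in> carrier R"
  shows "lincomb m q (Suc n) = lincomb m q n \<oplus>\<^bsub>M\<^esub> q n \<odot>\<^bsub>M\<^esub> m n"
proof -
  have "(\<lambda>i. q i \<odot>\<^bsub>M\<^esub> m i) \<in> {..<n} \<rightarrow> carrier M" "q n \<odot>\<^bsub>M\<^esub> m n \<in> carrier M"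
    using assms by auto
  then show ?thesis
    unfolding lincomb_def lessThan_Suc by (subst M.finsum_insert) (auto intro!: M.a_comm M.finsum_closed)
qed

lemma lincomb_cong:
  assumes "\<And>i. i < n \<Longrightarrow> m i \<in> carrier M" "\<And>i. i < n \<Longrightarrow> q i \<in> carrier R" "\<And>i. i < n \<Longrightarrow> p i = q i"
  shows "lincomb m p n = lincomb m q n"
  unfolding lincomb_def by (rule M.finsum_cong') (use assms in auto)

lemma lincomb_add:
  assumes "\<And>i. i < n \<Longrightarrow> m i \<in> carrier M" "\<And>i. i < n \<Longrightarrow> q i \<in> carrier R" "\<And>i. i < n \<Longrightarrow> p i \<in> carrier R"
  shows "lincomb m (\<lambda>i. p i \<oplus> q i) n = lincomb m p n \<oplus>\<^bsub>M\<^esub> lincomb m q n"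
proof -
  have "lincomb m (\<lambda>i. p i \<oplus> q i) n = (\<Oplus>\<^bsub>M\<^esub>i\<in>{..<n}. p i \<odot>\<^bsub>M\<^esub> m i \<oplus>\<^bsub>M\<^esub> q i \<odot>\<^bsub>M\<^esub> m i)"
    unfolding lincomb_def by (rule M.finsum_cong') (use assms in \<open>auto simp: smult_l_distr\<close>)
  also have "\<dots> = lincomb m p n \<oplus>\<^bsub>M\<^esub> lincomb m q n"
    unfolding lincomb_def by (rule M.finsum_addf) (use assms in auto)
  finally show ?thesis .
qed

lemma lincomb_smult:
  assumes "\<And>i. i < n \<Longrightarrow> m i \<in> carrier M" "\<And>i. i < n \<Longrightarrow> q i \<in> carrier R" "t \<in> carrier R"
  shows "lincomb m (\<lambda>i. t \<otimes> q i) n = t \<odot>\<^bsub>M\<^esub> lincomb m q n"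
proof -
  have "t \<odot>\<^bsub>M\<^esub> lincomb m q n = (\<Oplus>\<^bsub>M\<^esub>i\<in>{..<n}. t \<odot>\<^bsub>M\<^esub> (q i \<odot>\<^bsub>M\<^esub> m i))"
    unfolding lincomb_def by (rule finsum_smult_ldistr) (use assms in auto)
  also have "\<dots> = lincomb m (\<lambda>i. t \<otimes> q i) n"
    unfolding lincomb_def by (rule M.finsum_cong') (use assms in \<open>auto simp: smult_assoc1\<close>)
  finally show ?thesis by simp
qed

lemma lincomb_submodule:
  assumes N: "submodule N R M" and m: "\<And>i. i < n \<Longrightarrow> m i \<in> N" and q: "\<And>i. i < n \<Longrightarrow> q i \<in> carrier R"
  shows "lincomb m q n \<in> N"
  using m q
proof (induction n)
  case (Suc n)
  note E = submoduleE[OF N]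
  have "lincomb m q (Suc n) = lincomb m q n \<oplus>\<^bsub>M\<^esub> q n \<odot>\<^bsub>M\<^esub> m n"
    by (rule lincomb_Suc) (use Suc.prems E(1) in auto)
  moreover have "lincomb m q n \<in> N" using Suc by simp
  moreover have "q n \<odot>\<^bsub>M\<^esub> m n \<in> N" using E(4) Suc.prems by simp
  ultimately show ?case using E(5) by simp
qed (simp add: submodule_zero[OF N])

end

text \<open>Clears denominators, so that everything later takes place in \<open>R\<close> and
  \<open>M\<close>. The \<open>m i\<close> are numerators of a basis of the module of fractions; for
  them generation and independence survive up to factors from \<open>S\<close>.\<close>

lemma (in localization) free_of_rank_locD:
  assumes "free_of_rank (loc_ring R S) L r"
  obtains m where "\<And>i. i < r \<Longrightarrow> m i \<in> carrier M"
    and "\<And>x. x \<in> carrier M \<Longrightarrow> \<exists>s\<in>S. \<exists>q. (\<forall>i<r. q i \<in> carrier R) \<and> s \<odot>\<^bsub>M\<^esub> x = lincomb m q r"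
    and "\<And>q i. \<lbrakk>\<And>i. i < r \<Longrightarrow> q i \<in> carrier R; lincomb m q r = \<zero>\<^bsub>M\<^esub>; i < r\<rbrakk> \<Longrightarrow> \<exists>s\<in>S. s \<otimes> q i = \<zero>"
proof -
  interpret L: abelian_monoid L by (rule abelian_monoid_loc)
  obtain b where b: "b \<in> {..<r} \<rightarrow> carrier L"
    and ex1': "\<forall>x\<in>carrier L.
      \<exists>!a. a \<in> {..<r} \<rightarrow>\<^sub>E carrier (loc_ring R S) \<and> x = (\<Oplus>\<^bsub>L\<^esub>i\<in>{..<r}. a i \<odot>\<^bsub>L\<^esub> b i)"
    using assms unfolding free_of_rank_def by (rule bexE)
  note ex1 = bspec[OF ex1']
  have "\<forall>i<r. \<exists>m d. m \<in> carrier M \<and> d \<in> S \<and> b i = frac m d"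
  proof (intro allI impI)
    fix i assume "i < r"
    then have "b i \<in> carrier L" using b by blast
    then show "\<exists>m d. m \<in> carrier M \<and> d \<in> S \<and> b i = frac m d" by (rule fracE) blast
  qed
  then obtain m d where m: "\<And>i. i < r \<Longrightarrow> m i \<in> carrier M" and d: "\<And>i. i < r \<Longrightarrow> d i \<in> S"
    and bi: "\<And>i. i < r \<Longrightarrow> b i = frac (m i) (d i)" by metis
  have ab: "a i \<odot>\<^bsub>L\<^esub> b i \<in> carrier L" if "a i \<in> carrier (loc_ring R S)" "i < r" for a i
  proof -
    obtain p t where "p \<in> carrier R" "t \<in> S" "a i = sfrac p t" using sfracE[OF \<open>a i \<in> _\<close>] .
    then show ?thesis using bi m d S_mult that by (simp add: L_smult)
  qed
  have finsum_Suc: "(\<Oplus>\<^bsub>L\<^esub>i\<in>{..<Suc n}. a i \<odot>\<^bsub>L\<^esub> b i) = (\<Oplus>\<^bsub>L\<^esub>i\<in>{..<n}. a i \<odot>\<^bsub>L\<^esub> b i) \<oplus>\<^bsub>L\<^esub> a n \<odot>\<^bsub>L\<^esub> b n"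
    if "\<And>i. i < r \<Longrightarrow> a i \<in> carrier (loc_ring R S)" "n < r" for a n
  proof -
    have "(\<lambda>i. a i \<odot>\<^bsub>L\<^esub> b i) \<in> {..<n} \<rightarrow> carrier L" "a n \<odot>\<^bsub>L\<^esub> b n \<in> carrier L"
      using ab that by auto
    then show ?thesis
      unfolding lessThan_Suc by (subst L.finsum_insert) (auto intro!: L.a_comm L.finsum_closed)
  qed
  have span: "\<exists>q. (\<forall>i<n. q i \<in> carrier R) \<and> (\<exists>s\<in>S. (\<Oplus>\<^bsub>L\<^esub>i\<in>{..<n}. a i \<odot>\<^bsub>L\<^esub> b i) = frac (lincomb m q n) s)"
    if a: "\<And>i. i < r \<Longrightarrow> a i \<in> carrier (loc_ring R S)" and "n \<le> r" for a n
    using \<open>n \<le> r\<close>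
  proof (induction n)
    case 0
    show ?case using S_one by (auto simp: L_zero)
  next
    case (Suc n)
    then obtain q s where q: "\<And>i. i < n \<Longrightarrow> q i \<in> carrier R" and s: "s \<in> S"
      and eq: "(\<Oplus>\<^bsub>L\<^esub>i\<in>{..<n}. a i \<odot>\<^bsub>L\<^esub> b i) = frac (lincomb m q n) s" by auto
    obtain p t where p: "p \<in> carrier R" "t \<in> S" "a n = sfrac p t" 
      using sfracE[OF a[of n]] Suc.prems by (auto simp: Suc_le_eq)
    have n: "m n \<in> carrier M" "d n \<in> S" "n < r" using m d Suc.prems by auto
    \<comment> \<open>The new term is \<open>p \<odot> m n\<close> over \<open>s'\<close>. Over the
      common denominator \<open>s \<otimes> s'\<close> the old coefficients acquire the factor
      \<open>s'\<close>, and the new one becomes \<open>s \<otimes> p\<close>.\<close>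
    define s' where "s' = t \<otimes> d n"
    have s': "s' \<in> S" using p n S_mult by (simp add: s'_def)
    define q' where "q' = (\<lambda>i. if i < n then s' \<otimes> q i else s \<otimes> p)"
    have q': "q' i \<in> carrier R" if "i < Suc n" for i using that q s s' p by (auto simp: q'_def)
    have lc: "lincomb m q n \<in> carrier M" by (rule lincomb_closed) (use m q Suc.prems in auto)
    have "(\<Oplus>\<^bsub>L\<^esub>i\<in>{..<Suc n}. a i \<odot>\<^bsub>L\<^esub> b i) = frac (lincomb m q n) s \<oplus>\<^bsub>L\<^esub> a n \<odot>\<^bsub>L\<^esub> b n"
      using finsum_Suc[of a n] a n eq by simp
    also have "\<dots> = frac (s' \<odot>\<^bsub>M\<^esub> lincomb m q n \<oplus>\<^bsub>M\<^esub> s \<odot>\<^bsub>M\<^esub> (p \<odot>\<^bsub>M\<^esub> m n)) (s \<otimes> s')"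
      using n p s s' lc by (simp add: bi L_smult L_add s'_def)
    also have "s' \<odot>\<^bsub>M\<^esub> lincomb m q n \<oplus>\<^bsub>M\<^esub> s \<odot>\<^bsub>M\<^esub> (p \<odot>\<^bsub>M\<^esub> m n) = lincomb m q' (Suc n)"
    proof -
      have "lincomb m q' (Suc n) = lincomb m q' n \<oplus>\<^bsub>M\<^esub> q' n \<odot>\<^bsub>M\<^esub> m n"
        by (rule lincomb_Suc) (use q' m Suc.prems in auto)
      moreover have "lincomb m q' n = lincomb m (\<lambda>i. s' \<otimes> q i) n"
        by (rule lincomb_cong) (use q m s' Suc.prems in \<open>auto simp: q'_def\<close>)
      moreover have "\<dots> = s' \<odot>\<^bsub>M\<^esub> lincomb m q n"
        by (rule lincomb_smult) (use q m s' Suc.prems in auto)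
      ultimately show ?thesis using n p s by (simp add: q'_def smult_assoc1)
    qed
    finally show ?case using q' s s' S_mult by blast
  qed
  have "\<exists>s\<in>S. \<exists>q. (\<forall>i<r. q i \<in> carrier R) \<and> s \<odot>\<^bsub>M\<^esub> x = lincomb m q r" if x: "x \<in> carrier M" for x
  proof -
    obtain a where a: "a \<in> {..<r} \<rightarrow>\<^sub>E carrier (loc_ring R S)" "frac x \<one> = (\<Oplus>\<^bsub>L\<^esub>i\<in>{..<r}. a i \<odot>\<^bsub>L\<^esub> b i)"
      using ex1[OF frac_closed[OF x S_one]] by blast
    have a': "a i \<in> carrier (loc_ring R S)" if "i < r" for i using a(1) that by auto
    obtain q s where q: "\<And>i. i < r \<Longrightarrow> q i \<in> carrier R" and s: "s \<in> S"
      and eq: "frac x \<one> = frac (lincomb m q r) s"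
      using span[of a r] a' a(2) by auto
    have lc: "lincomb m q r \<in> carrier M" by (rule lincomb_closed) (use m q in auto)
    obtain u where u: "u \<in> S" "(u \<otimes> s) \<odot>\<^bsub>M\<^esub> x = (u \<otimes> \<one>) \<odot>\<^bsub>M\<^esub> lincomb m q r"
      using eq frac_eq_iff[OF x S_one lc s] by blast
    have "(u \<otimes> \<one>) \<odot>\<^bsub>M\<^esub> lincomb m q r = lincomb m (\<lambda>i. u \<otimes> q i) r"
      by (subst lincomb_smult) (use m q u in auto)
    then have "(u \<otimes> s) \<odot>\<^bsub>M\<^esub> x = lincomb m (\<lambda>i. u \<otimes> q i) r"
      by (simp only: u(2))
    moreover have "\<forall>i<r. u \<otimes> q i \<in> carrier R" using q u(1) by simp
    ultimately show ?thesis using S_mult[OF u(1) s] by (intro bexI exI conjI)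
  qed
  moreover have "\<exists>s\<in>S. s \<otimes> q i = \<zero>"
    if q: "\<And>i. i < r \<Longrightarrow> q i \<in> carrier R" and q0: "lincomb m q r = \<zero>\<^bsub>M\<^esub>" and i: "i < r" for q i
  proof -
    \<comment> \<open>As \<open>b i\<close> is \<open>m i\<close> over \<open>d i\<close>, the
      coefficient \<open>q i \<otimes> d i\<close> of \<open>b i\<close> produces
      \<open>q i \<odot> m i\<close>. The restriction to \<open>{..<r}\<close> is there because
      uniqueness in \<open>free_of_rank\<close> concerns extensional families.\<close>
    define A where "A q = (\<lambda>i\<in>{..<r}. sfrac (q i \<otimes> d i) \<one>)" for q :: "nat \<Rightarrow> 'a"
    have A: "A q \<in> {..<r} \<rightarrow>\<^sub>E carrier (loc_ring R S)" if "\<And>i. i < r \<Longrightarrow> q i \<in> carrier R" for q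
      using that d S_one by (auto simp: A_def intro!: sfrac_closed)
    have sumA: "(\<Oplus>\<^bsub>L\<^esub>i\<in>{..<n}. A q i \<odot>\<^bsub>L\<^esub> b i) = frac (lincomb m q n) \<one>"
      if q: "\<And>i. i < r \<Longrightarrow> q i \<in> carrier R" and "n \<le> r" for q n
      using \<open>n \<le> r\<close>
    proof (induction n)
      case 0 show ?case by (simp add: L_zero)
    next
      case (Suc n)
      have n: "m n \<in> carrier M" "d n \<in> S" "n < r" "q n \<in> carrier R" using m d q Suc.prems by auto
      have lc: "lincomb m q n \<in> carrier M" by (rule lincomb_closed) (use m q Suc.prems in auto)
      have "A q n \<odot>\<^bsub>L\<^esub> b n = frac ((q n \<otimes> d n) \<odot>\<^bsub>M\<^esub> m n) (\<one> \<otimes> d n)"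
        using n S_one by (simp add: A_def bi L_smult)
      also have "\<dots> = frac (q n \<odot>\<^bsub>M\<^esub> m n) \<one>"
        by (rule frac_eqI[OF _ _ _ _ S_one]) (use n S_one in \<open>auto simp: smult_assoc1[symmetric] R.m_comm\<close>)
      finally have An: "A q n \<odot>\<^bsub>L\<^esub> b n = frac (q n \<odot>\<^bsub>M\<^esub> m n) \<one>" .
      have "(\<Oplus>\<^bsub>L\<^esub>i\<in>{..<Suc n}. A q i \<odot>\<^bsub>L\<^esub> b i) = (\<Oplus>\<^bsub>L\<^esub>i\<in>{..<n}. A q i \<odot>\<^bsub>L\<^esub> b i) \<oplus>\<^bsub>L\<^esub> A q n \<odot>\<^bsub>L\<^esub> b n"
        using A[of q] q n by (intro finsum_Suc) (auto simp: PiE_iff)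
      also have "\<dots> = frac (lincomb m q n \<oplus>\<^bsub>M\<^esub> q n \<odot>\<^bsub>M\<^esub> m n) \<one>"
        using Suc lc n S_one by (simp add: An L_add)
      also have "lincomb m q n \<oplus>\<^bsub>M\<^esub> q n \<odot>\<^bsub>M\<^esub> m n = lincomb m q (Suc n)"
        by (rule lincomb_Suc[symmetric]) (use m q Suc.prems in auto)
      finally show ?case .
    qed
    \<comment> \<open>The trivial relation is put through \<open>A\<close> as well. Both sums are
      then given by \<open>sumA\<close>, and uniqueness of the expansion of zero identifies the two
      families.\<close>
    let ?z = "\<lambda>_::nat. \<zero>"
    have z: "lincomb m ?z r = \<zero>\<^bsub>M\<^esub>"
      using lincomb_smult[of r m ?z \<zero>] m lincomb_closed[of r m ?z] by simp
    have "\<zero>\<^bsub>L\<^esub> = (\<Oplus>\<^bsub>L\<^esub>i\<in>{..<r}. A q i \<odot>\<^bsub>L\<^esub> b i)" "\<zero>\<^bsub>L\<^esub> = (\<Oplus>\<^bsub>L\<^esub>i\<in>{..<r}. A ?z i \<odot>\<^bsub>L\<^esub> b i)"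
      using sumA[of q r] sumA[of ?z r] q q0 z by (auto simp: L_zero)
    moreover have "A q \<in> {..<r} \<rightarrow>\<^sub>E carrier (loc_ring R S)" "A ?z \<in> {..<r} \<rightarrow>\<^sub>E carrier (loc_ring R S)"
      using q by (auto intro!: A)
    ultimately have "A q = A ?z"
      using ex1[OF L.zero_closed] by blast
    then have "A q i = A ?z i" by (rule fun_cong)
    then have "sfrac (q i \<otimes> d i) \<one> = sfrac (\<zero> \<otimes> d i) \<one>"
      using i by (simp add: A_def)
    then obtain u where u: "u \<in> S" "u \<otimes> \<one> \<otimes> (q i \<otimes> d i) = u \<otimes> \<one> \<otimes> (\<zero> \<otimes> d i)"
      using sfrac_eqD[of "q i \<otimes> d i" \<one> "\<zero> \<otimes> d i" \<one>] q[OF i] d[OF i] S_one by auto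
    then have "(u \<otimes> d i) \<otimes> q i = \<zero>"
      using q[OF i] d[OF i] by (simp add: R.m_ac)
    then show ?thesis using u(1) d[OF i] S_mult by blast
  qed
  ultimately show thesis using that[of m] m by blast
qed

section \<open>Ideals of a Noetherian ring\<close>

lemma (in cring) ideal_cringI:
  assumes "J \<subseteq> carrier R" "\<zero> \<in> J" "\<And>a b. \<lbrakk>a \<in> J; b \<in> J\<rbrakk> \<Longrightarrow> a \<oplus> b \<in> J"
    and mult: "\<And>a x. \<lbrakk>a \<in> J; x \<in> carrier R\<rbrakk> \<Longrightarrow> x \<otimes> a \<in> J"
  shows "ideal J R"
proof (rule idealI[OF ring_axioms])
  show "subgroup J (add_monoid R)"
  proof (rule group.subgroupI[OF a_group])
    fix a assume a: "a \<in> J"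
    then have ac: "a \<in> carrier R" using assms(1) by blast
    have "\<ominus> a = (\<ominus> \<one>) \<otimes> a" using ac by (simp add: l_minus)
    then show "inv\<^bsub>add_monoid R\<^esub> a \<in> J" using mult[OF a, of "\<ominus> \<one>"] by (simp add: a_inv_def)
  qed (use assms in auto)
  fix a x assume "a \<in> J" "x \<in> carrier R"
  moreover from this have "a \<otimes> x = x \<otimes> a" using assms(1) m_comm by blast
  ultimately show "x \<otimes> a \<in> J" "a \<otimes> x \<in> J" using mult by simp_all
qed

text \<open>Zorn's lemma for the proper ideals containing \<open>J\<close>. In a Noetherian ring the
  union of a nonempty chain of ideals is a member of the chain, hence again proper; a maximal
  element is a maximal ideal and therefore prime.\<close>

lemma (in cring) prime_ideal_exists:
  assumes "noetherian_ring R" and J: "ideal J R" "J \<noteq> carrier R"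
  shows "\<exists>P. primeideal P R \<and> J \<subseteq> P"
proof -
  interpret noetherian_ring R by fact
  let ?A = "{I. ideal I R \<and> J \<subseteq> I \<and> I \<noteq> carrier R}"
  have "\<exists>P\<in>?A. \<forall>X\<in>?A. P \<subseteq> X \<longrightarrow> X = P"
  proof (rule subset_Zorn_nonempty)
    show "?A \<noteq> {}" using J by blast
    fix \<C> assume ne: "\<C> \<noteq> {}" and chain: "subset.chain ?A \<C>"
    have "subset.chain {I. ideal I R} \<C>"
      using chain unfolding subset_chain_def by blast
    then have "\<Union>\<C> \<in> \<C>" by (rule ideal_chain_is_trivial[OF ne])
    then show "\<Union>\<C> \<in> ?A" using chain unfolding subset_chain_def by (meson subsetD)
  qed
  then obtain P where "P \<in> ?A" and max: "\<forall>X\<in>?A. P \<subseteq> X \<longrightarrow> X = P" by (rule bexE)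
  then have P: "ideal P R" "J \<subseteq> P" "P \<noteq> carrier R" by simp_all
  have "maximalideal P R"
  proof (rule maximalidealI[OF P(1)])
    show "carrier R \<noteq> P" using P(3) by blast
    show "X = P \<or> X = carrier R" if "ideal X R" "P \<subseteq> X" "X \<subseteq> carrier R" for X
      using max that P(2) by (metis (mono_tags, lifting) mem_Collect_eq order_trans)
  qed
  then show ?thesis using maximalideal_prime P(2) by blast
qed

lemma (in primeideal) nat_pow_mem:
  assumes "f \<in> carrier R" "f [^] (n::nat) \<in> I"
  shows "f \<in> I"
  using assms(2)
proof (induction n)
  case 0
  then have "\<one> \<in> I" by simp
  then have "I = carrier R" by (rule one_imp_carrier)
  then show ?case using I_notcarr by simp
next
  case (Suc n)
  then show ?case using I_prime[of "f [^] n" f] assms(1) by auto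
qed

text \<open>Serves to test \<open>x \<in> N\<close> at the primes: if no prime contains this ideal,
  it contains \<open>\<one>\<close>.\<close>

lemma (in module) colon_ideal:
  assumes N: "submodule N R M" and x: "x \<in> carrier M"
  shows "ideal {c \<in> carrier R. c \<odot>\<^bsub>M\<^esub> x \<in> N} R"
proof (rule R.ideal_cringI)
  show "a \<oplus> b \<in> {c \<in> carrier R. c \<odot>\<^bsub>M\<^esub> x \<in> N}"
    if "a \<in> {c \<in> carrier R. c \<odot>\<^bsub>M\<^esub> x \<in> N}" "b \<in> {c \<in> carrier R. c \<odot>\<^bsub>M\<^esub> x \<in> N}" for a b
    using that x submoduleE(5)[OF N] by (simp add: smult_l_distr)
  show "y \<otimes> a \<in> {c \<in> carrier R. c \<odot>\<^bsub>M\<^esub> x \<in> N}"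
    if "a \<in> {c \<in> carrier R. c \<odot>\<^bsub>M\<^esub> x \<in> N}" "y \<in> carrier R" for a y
    using that x submoduleE(4)[OF N] by (simp add: smult_assoc1)
qed (use x submodule_zero[OF N] in auto)

text \<open>The elements killed by some power of \<open>f\<close> are the kernel of the map from
  \<open>R\<close> to its localization at \<open>f\<close>. The annihilators of the powers form an
  ascending chain of ideals; where it becomes stationary, a single power \<open>f^N\<close> kills
  the whole kernel.\<close>

lemma (in noetherian_ring) annihilator_stable:
  assumes "cring R" and f: "f \<in> carrier R"
  obtains N :: nat where "\<And>c k. \<lbrakk>c \<in> carrier R; f [^] (k::nat) \<otimes> c = \<zero>\<rbrakk> \<Longrightarrow> f [^] N \<otimes> c = \<zero>"
proof -
  interpret cring R by fact
  let ?a = "\<lambda>k::nat. {c \<in> carrier R. f [^] k \<otimes> c = \<zero>}"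
  have ideal: "ideal (?a k) R" for k
    using f by (intro ideal_cringI) (auto simp: r_distr m_lcomm[of "f [^] k"])
  have mono: "?a k \<subseteq> ?a l" if "k \<le> l" for k l
  proof
    fix c assume c: "c \<in> ?a k"
    have "f [^] l = f [^] (l - k) \<otimes> f [^] k" using that f by (simp add: nat_pow_mult)
    then show "c \<in> ?a l" using c f by (simp add: m_assoc)
  qed
  have "subset.chain {I. ideal I R} (range ?a)"
    unfolding subset_chain_def
  proof (intro conjI ballI)
    show "range ?a \<subseteq> {I. ideal I R}" using ideal by blast
    fix X Y assume "X \<in> range ?a" "Y \<in> range ?a"
    then obtain k l where "X = ?a k" "Y = ?a l" by blast
    then show "X \<subseteq> Y \<or> Y \<subseteq> X"
      using mono[of k l] mono[of l k] linear[of k l] by (simp only:) blast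
  qed
  then have "\<Union>(range ?a) \<in> range ?a" by (rule ideal_chain_is_trivial[rotated]) simp
  then obtain N where N: "\<Union>(range ?a) = ?a N" by (rule rangeE)
  have "f [^] N \<otimes> c = \<zero>" if "c \<in> carrier R" "f [^] k \<otimes> c = \<zero>" for c and k :: nat
  proof -
    have "c \<in> ?a k" using that by simp
    then have "c \<in> ?a N" unfolding N[symmetric] by (rule UN_I[OF UNIV_I])
    then show ?thesis by simp
  qed
  then show thesis using that[of N] by blast
qed

lemma (in module) localization_powers:
  assumes f: "f \<in> carrier R"
  shows "localization R M (powers R f)"
proof (intro localization.intro localization_axioms.intro module_axioms)
  show "powers R f \<subseteq> carrier R" using f by (auto simp: powers_def)
  show "\<one> \<in> powers R f" unfolding powers_def by (rule image_eqI[of _ _ 0]) auto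
  show "s \<otimes> t \<in> powers R f" if "s \<in> powers R f" "t \<in> powers R f" for s t
    using that f by (auto simp: powers_def R.nat_pow_mult)
qed

lemma (in module) free_of_rank_powersD:
  assumes f: "f \<in> carrier R"
    and "free_of_rank (loc_ring R (powers R f)) (loc_module R (powers R f) M) r"
  obtains m where "\<And>i. i < r \<Longrightarrow> m i \<in> carrier M"
    and "\<And>x. x \<in> carrier M \<Longrightarrow>
      \<exists>k::nat. \<exists>q. (\<forall>i<r. q i \<in> carrier R) \<and> f [^] k \<odot>\<^bsub>M\<^esub> x = lincomb m q r"
    and "\<And>q i. \<lbrakk>\<And>i. i < r \<Longrightarrow> q i \<in> carrier R; lincomb m q r = \<zero>\<^bsub>M\<^esub>; i < r\<rbrakk>
      \<Longrightarrow> \<exists>k::nat. f [^] k \<otimes> q i = \<zero>"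
proof (rule localization.free_of_rank_locD[OF localization_powers[OF f] assms(2)])
  fix m
  assume 1: "\<And>i. i < r \<Longrightarrow> m i \<in> carrier M"
    and 2: "\<And>x. x \<in> carrier M \<Longrightarrow>
      \<exists>s\<in>powers R f. \<exists>q. (\<forall>i<r. q i \<in> carrier R) \<and> s \<odot>\<^bsub>M\<^esub> x = lincomb m q r"
    and 3: "\<And>q i. \<lbrakk>\<And>i. i < r \<Longrightarrow> q i \<in> carrier R; lincomb m q r = \<zero>\<^bsub>M\<^esub>; i < r\<rbrakk>
      \<Longrightarrow> \<exists>s\<in>powers R f. s \<otimes> q i = \<zero>"
  show thesis
  proof (rule that[of m])
    show "\<exists>k::nat. \<exists>q. (\<forall>i<r. q i \<in> carrier R) \<and> f [^] k \<odot>\<^bsub>M\<^esub> x = lincomb m q r"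
      if "x \<in> carrier M" for x using 2[OF that] unfolding powers_def by simp
    show "\<exists>k::nat. f [^] k \<otimes> q i = \<zero>"
      if "\<And>i. i < r \<Longrightarrow> q i \<in> carrier R" "lincomb m q r = \<zero>\<^bsub>M\<^esub>" "i < r" for q i
      using 3[of q i] that unfolding powers_def by simp
  qed (rule 1)
qed

section \<open>Locally free modules over a Noetherian ring\<close>

definition (in module) span :: "'c set \<Rightarrow> 'c set" where
  "span T = \<Inter>{N. submodule N R M \<and> T \<subseteq> N}"

context module
begin

lemma submodule_span: "T \<subseteq> carrier M \<Longrightarrow> submodule (span T) R M"
  unfolding span_def by (rule submodule_Inter) (use carrier_is_submodule in auto)

lemma span_incl: "T \<subseteq> span T"
  unfolding span_def by blast

lemma span_minimal: "\<lbrakk>submodule N R M; T \<subseteq> N\<rbrakk> \<Longrightarrow> span T \<subseteq> N"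
  unfolding span_def by blast

lemma span_mono: "T \<subseteq> T' \<Longrightarrow> span T \<subseteq> span T'"
  unfolding span_def by blast

text \<open>Quasi-compactness of the spectrum, phrased with ideals. Finitely many generators are
  what later bounds the power of \<open>f\<close> that carries the elements of \<open>M\<close> into
  the span of a local basis.\<close>

lemma locally_free_finitely_generated:
  assumes noeth: "noetherian_ring R" and lf: "locally_free_of_rank R M r"
  obtains T where "finite T" "T \<subseteq> carrier M" "span T = carrier M"
proof -
  \<comment> \<open>\<open>good f T\<close>: the elements of \<open>T\<close> generate \<open>M\<close> locally on \<open>D(f)\<close>. Finite sets can be united, so
    these \<open>f\<close> form an ideal.\<close>
  define good where "good f T \<longleftrightarrow> finite T \<and> T \<subseteq> carrier M \<and>
    (\<forall>x\<in>carrier M. \<forall>P. primeideal P R \<longrightarrow> f \<notin> P \<longrightarrow> (\<exists>c\<in>carrier R - P. c \<odot>\<^bsub>M\<^esub> x \<in> span T))" for f T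
  let ?J = "{f \<in> carrier R. \<exists>T. good f T}"
  have goodD: "\<exists>c\<in>carrier R - P. c \<odot>\<^bsub>M\<^esub> x \<in> span T"
    if "good f T" "x \<in> carrier M" "primeideal P R" "f \<notin> P" for f T x P
    using that unfolding good_def by blast
  have ideal: "ideal ?J R"
  proof (rule R.ideal_cringI)
    \<comment> \<open>Vacuous, as zero lies in every prime.\<close>
    have "good \<zero> {}"
      unfolding good_def using additive_subgroup.zero_closed ideal.axioms(1) primeideal.axioms(1) by blast
    then show "\<zero> \<in> ?J" by blast
  next
    fix a b assume "a \<in> ?J" "b \<in> ?J"
    then obtain T U where T: "good a T" "good b U" and ab: "a \<in> carrier R" "b \<in> carrier R" by blast
    have "good (a \<oplus> b) (T \<union> U)"
      unfolding good_def
    proof (intro conjI ballI allI impI)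
      show "finite (T \<union> U)" "T \<union> U \<subseteq> carrier M" using T unfolding good_def by auto
      fix x P assume x: "x \<in> carrier M" and P: "primeideal P R" and nP: "a \<oplus> b \<notin> P"
      \<comment> \<open>\<open>D(a + b)\<close> is covered by \<open>D(a)\<close> and
        \<open>D(b)\<close>.\<close>
      have "a \<notin> P \<or> b \<notin> P"
        using nP additive_subgroup.a_closed[OF ideal.axioms(1)[OF primeideal.axioms(1)[OF P]]] by blast
      then show "\<exists>c\<in>carrier R - P. c \<odot>\<^bsub>M\<^esub> x \<in> span (T \<union> U)"
        using goodD[OF T(1) x P] goodD[OF T(2) x P] span_mono[of T "T \<union> U"] span_mono[of U "T \<union> U"]
        by blast
    qed
    then show "a \<oplus> b \<in> ?J" using ab by blast
  next
    fix a y assume "a \<in> ?J" and y: "y \<in> carrier R"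
    then obtain T where T: "good a T" and a: "a \<in> carrier R" by blast
    have "good (y \<otimes> a) T"
      using T ideal.I_l_closed[OF primeideal.axioms(1) _ y] unfolding good_def by blast
    then show "y \<otimes> a \<in> ?J" using a y by blast
  qed blast
  have "?J = carrier R"
  proof (rule ccontr)
    assume "?J \<noteq> carrier R"
    then obtain P where P: "primeideal P R" "?J \<subseteq> P"
      using R.prime_ideal_exists[OF noeth ideal] by blast
    then obtain f where f: "f \<in> carrier R" "f \<notin> P"
      and free: "free_of_rank (loc_ring R (powers R f)) (loc_module R (powers R f) M) r"
      using lf unfolding locally_free_of_rank_def by blast
    obtain m where m: "\<And>i. i < r \<Longrightarrow> m i \<in> carrier M"
      and sp: "\<And>x. x \<in> carrier M \<Longrightarrow>
        \<exists>k::nat. \<exists>q. (\<forall>i<r. q i \<in> carrier R) \<and> f [^] k \<odot>\<^bsub>M\<^esub> x = lincomb m q r"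
      and "\<And>q i. \<lbrakk>\<And>i. i < r \<Longrightarrow> q i \<in> carrier R; lincomb m q r = \<zero>\<^bsub>M\<^esub>; i < r\<rbrakk>
        \<Longrightarrow> \<exists>k::nat. f [^] k \<otimes> q i = \<zero>"
      using free_of_rank_powersD[OF f(1) free] by blast
    have sub: "m ` {..<r} \<subseteq> carrier M" using m by blast
    \<comment> \<open>At every prime that avoids \<open>f\<close> the multiplier sought is a power
      of \<open>f\<close>, which depends on \<open>x\<close> but not on the prime.\<close>
    have "good f (m ` {..<r})"
      unfolding good_def
    proof (intro conjI ballI allI impI)
      fix x Q assume x: "x \<in> carrier M" and Q: "primeideal Q R" "f \<notin> Q"
      obtain k :: nat and q where q: "\<And>i. i < r \<Longrightarrow> q i \<in> carrier R" "f [^] k \<odot>\<^bsub>M\<^esub> x = lincomb m q r"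
        using sp[OF x] by blast
      have "lincomb m q r \<in> span (m ` {..<r})"
        by (rule lincomb_submodule[OF submodule_span[OF sub]]) (use q span_incl[of "m ` {..<r}"] in blast)+
      moreover have "f [^] k \<notin> Q" using primeideal.nat_pow_mem[OF Q(1) f(1)] Q(2) by blast
      ultimately show "\<exists>c\<in>carrier R - Q. c \<odot>\<^bsub>M\<^esub> x \<in> span (m ` {..<r})"
        using q(2) f(1) by (intro bexI[of _ "f [^] k"]) auto
    qed (simp_all add: sub)
    then show False using f P(2) by blast
  qed
  then have "\<one> \<in> ?J" by simp
  then obtain T where T: "good \<one> T" by blast
  have sub: "T \<subseteq> carrier M" "finite T" using T by (auto simp: good_def)
  have "x \<in> span T" if x: "x \<in> carrier M" for x
  proof -
    \<comment> \<open>At every prime \<open>P\<close>, \<open>good \<one> T\<close> yields an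
      element of this ideal outside \<open>P\<close>, and a proper ideal would be contained in some
      prime.\<close>
    let ?I = "{c \<in> carrier R. c \<odot>\<^bsub>M\<^esub> x \<in> span T}"
    have "?I = carrier R"
    proof (rule ccontr)
      assume "?I \<noteq> carrier R"
      then obtain P where P: "primeideal P R" "?I \<subseteq> P"
        using R.prime_ideal_exists[OF noeth colon_ideal[OF submodule_span[OF sub(1)] x]] by blast
      have "\<one> \<notin> P"
        using ideal.one_imp_carrier[OF primeideal.axioms(1)[OF P(1)]] primeideal.I_notcarr[OF P(1)] by blast
      then show False using goodD[OF T x P(1)] P(2) by blast
    qed
    then have "\<one> \<in> ?I" by simp
    then show ?thesis using x by simp
  qed
  then have "span T = carrier M" using submoduleE(1)[OF submodule_span[OF sub(1)]] by blast
  then show thesis using that sub by blast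
qed

text \<open>The coefficients of \<open>f^L x\<close> with respect to the \<open>m i\<close> are
  determined only up to elements killed by powers of \<open>f\<close>. Multiplied by
  \<open>f^N\<close> they no longer depend on any choice and are linear in \<open>x\<close>. These
  are the coordinate functions \<open>\<phi> i\<close>, and the sum of the
  \<open>\<phi> i x \<odot> m i\<close> is \<open>f^(N + L) x\<close>.\<close>

lemma finite_rank_of_local_basis:
  assumes noeth: "noetherian_ring R" and f: "f \<in> carrier R"
    and free: "free_of_rank (loc_ring R (powers R f)) (loc_module R (powers R f) M) r"
    and T: "finite T" "T \<subseteq> carrier M" "span T = carrier M"
  shows "\<exists>k::nat. finite_rank R M (carrier M) {\<zero>\<^bsub>M\<^esub>} (\<lambda>x. f [^] k \<odot>\<^bsub>M\<^esub> x)"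
proof -
  obtain m where m: "\<And>i. i < r \<Longrightarrow> m i \<in> carrier M"
    and sp: "\<And>x. x \<in> carrier M \<Longrightarrow>
      \<exists>k::nat. \<exists>q. (\<forall>i<r. q i \<in> carrier R) \<and> f [^] k \<odot>\<^bsub>M\<^esub> x = lincomb m q r"
    and ind: "\<And>q i. \<lbrakk>\<And>i. i < r \<Longrightarrow> q i \<in> carrier R; lincomb m q r = \<zero>\<^bsub>M\<^esub>; i < r\<rbrakk>
      \<Longrightarrow> \<exists>k::nat. f [^] k \<otimes> q i = \<zero>"
    using free_of_rank_powersD[OF f free] by blast
  obtain N :: nat where N: "\<And>c k. \<lbrakk>c \<in> carrier R; f [^] (k::nat) \<otimes> c = \<zero>\<rbrakk> \<Longrightarrow> f [^] N \<otimes> c = \<zero>"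
    using noetherian_ring.annihilator_stable[OF noeth R.is_cring f] by blast
  have fc: "f [^] (k::nat) \<in> carrier R" for k using f by simp
  define has where "has k x q \<longleftrightarrow> (\<forall>i<r. q i \<in> carrier R) \<and> f [^] (k::nat) \<odot>\<^bsub>M\<^esub> x = lincomb m q r"
    for k x q
  have has_smult: "has k (c \<odot>\<^bsub>M\<^esub> x) (\<lambda>i. c \<otimes> q i)" if "has k x q" "c \<in> carrier R" "x \<in> carrier M" for k c x q
    using that m fc lincomb_smult[of r m q c] unfolding has_def
    by (simp add: smult_assoc1[symmetric] R.m_comm[of _ c]) (simp add: smult_assoc1)
  have has_add: "has k (x \<oplus>\<^bsub>M\<^esub> y) (\<lambda>i. p i \<oplus> q i)"
    if "has k x p" "has k y q" "x \<in> carrier M" "y \<in> carrier M" for k x y p q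
    using that m fc lincomb_add[of r m q p] unfolding has_def by (simp add: smult_r_distr)
  have has_mono: "\<exists>q. has l x q" if "has k x q" "k \<le> l" "x \<in> carrier M" for k l x q
  proof -
    have "f [^] l = f [^] (l - k) \<otimes> f [^] k" using that f by (simp add: R.nat_pow_mult)
    then have "has l x (\<lambda>i. f [^] (l - k) \<otimes> q i)"
      using that m fc lincomb_smult[of r m q "f [^] (l - k)"] unfolding has_def by (simp add: smult_assoc1)
    then show ?thesis by blast
  qed
  \<comment> \<open>Coefficients of two elements can be added only at the same exponent, so one
    exponent has to serve all of \<open>M\<close>. A maximum over the generators is enough, because
    the elements that admit the exponent \<open>L\<close> form a submodule.\<close>
  have "\<exists>L. \<forall>x\<in>T. \<exists>q. has L x q"
    using T(1,2)
  proof (induction T rule: finite_induct)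
    case (insert x T)
    then obtain L where L: "\<forall>x\<in>T. \<exists>q. has L x q" by blast
    obtain k q where k: "has k x q" using sp[of x] insert.prems unfolding has_def by blast
    have "\<exists>q. has (max k L) y q" if "y \<in> insert x T" for y
    proof (cases "y = x")
      case True then show ?thesis using has_mono[OF k, of "max k L"] insert.prems by simp
    next
      case False
      then have "y \<in> T" using that by simp
      moreover from this obtain p where "has L y p" using L by blast
      ultimately show ?thesis using has_mono[of L y p "max k L"] insert.prems by auto
    qed
    then show ?case by blast
  qed simp
  then obtain L where L: "\<And>x. x \<in> T \<Longrightarrow> \<exists>q. has L x q" by blast
  have has0: "has L \<zero>\<^bsub>M\<^esub> (\<lambda>_. \<zero>)"
    using lincomb_smult[of r m "\<lambda>_. \<zero>" \<zero>] m fc lincomb_closed[of r m "\<lambda>_. \<zero>"] by (simp add: has_def)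
  have "submodule {x \<in> carrier M. \<exists>q. has L x q} R M"
  proof (rule submoduleI)
    show sm: "c \<odot>\<^bsub>M\<^esub> x \<in> {x \<in> carrier M. \<exists>q. has L x q}"
      if "c \<in> carrier R" "x \<in> {x \<in> carrier M. \<exists>q. has L x q}" for c x
      using that has_smult by blast
    show "\<ominus>\<^bsub>M\<^esub> x \<in> {x \<in> carrier M. \<exists>q. has L x q}" if x: "x \<in> {x \<in> carrier M. \<exists>q. has L x q}" for x
      using sm[of "\<ominus> \<one>" x] x smult_l_minus[of \<one> x] by simp
    show "x \<oplus>\<^bsub>M\<^esub> y \<in> {x \<in> carrier M. \<exists>q. has L x q}"
      if "x \<in> {x \<in> carrier M. \<exists>q. has L x q}" "y \<in> {x \<in> carrier M. \<exists>q. has L x q}" for x y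
      using that has_add by blast
  qed (use has0 in auto)
  then have "span T \<subseteq> {x \<in> carrier M. \<exists>q. has L x q}"
    by (rule span_minimal) (use L T(2) in auto)
  then have ex: "\<exists>q. has L x q" if "x \<in> carrier M" for x using that T(3) by blast
  \<comment> \<open>An arbitrary choice, with no linearity in \<open>x\<close>; only the multiples
    \<open>\<phi>\<close> by \<open>f^N\<close> are linear.\<close>
  define Q where "Q x = (SOME q. has L x q)" for x
  have Q: "has L x (Q x)" if "x \<in> carrier M" for x
    unfolding Q_def using ex[OF that] by (rule someI_ex)
  define \<phi> where "\<phi> i x = f [^] N \<otimes> Q x i" for i x
  have Qc: "Q x i \<in> carrier R" if "x \<in> carrier M" "i < r" for x i using Q[OF that(1)] that(2) by (simp add: has_def)
  have \<phi>: "\<phi> i x = f [^] N \<otimes> q i" if q: "has L x q" and x: "x \<in> carrier M" and i: "i < r" for x q i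
  proof -
    \<comment> \<open>The difference of two coefficient families of \<open>x\<close> is a
      coefficient family of \<open>x + (-1) x\<close>, that is, of zero. By \<open>ind\<close> its
      entries are killed by powers of \<open>f\<close>, hence by \<open>f^N\<close>.\<close>
    have "has L (\<ominus> \<one> \<odot>\<^bsub>M\<^esub> x) (\<lambda>i. \<ominus> \<one> \<otimes> q i)" using has_smult[OF q _ x] by simp
    then have "has L (x \<oplus>\<^bsub>M\<^esub> (\<ominus> \<one> \<odot>\<^bsub>M\<^esub> x)) (\<lambda>i. Q x i \<oplus> \<ominus> \<one> \<otimes> q i)"
      using has_add[OF Q[OF x]] x by simp
    moreover have "x \<oplus>\<^bsub>M\<^esub> (\<ominus> \<one> \<odot>\<^bsub>M\<^esub> x) = \<zero>\<^bsub>M\<^esub>" using x by (simp add: smult_l_minus M.r_neg)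
    ultimately have h: "has L \<zero>\<^bsub>M\<^esub> (\<lambda>i. Q x i \<oplus> \<ominus> \<one> \<otimes> q i)" by simp
    then obtain k :: nat where "f [^] k \<otimes> (Q x i \<oplus> \<ominus> \<one> \<otimes> q i) = \<zero>"
      using ind[of "\<lambda>i. Q x i \<oplus> \<ominus> \<one> \<otimes> q i" i] i fc by (auto simp: has_def)
    moreover have qi: "q i \<in> carrier R" "Q x i \<in> carrier R" using q Q[OF x] i by (auto simp: has_def)
    ultimately have "f [^] N \<otimes> (Q x i \<oplus> \<ominus> \<one> \<otimes> q i) = \<zero>" by (intro N[of _ k]) auto
    then have "f [^] N \<otimes> Q x i \<oplus> \<ominus> (f [^] N \<otimes> q i) = \<zero>"
      using qi fc by (simp add: R.r_distr R.l_minus R.r_minus)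
    then show ?thesis
      unfolding \<phi>_def using qi fc by (metis R.add.inv_closed R.m_closed R.minus_equality R.minus_minus)
  qed
  have form: "form_on R M (carrier M) {\<zero>\<^bsub>M\<^esub>} (\<phi> i)" if i: "i < r" for i
    unfolding form_on_def
  proof (intro conjI ballI)
    fix x assume x: "x \<in> carrier M"
    show "\<phi> i x \<in> carrier R" using Qc[OF x i] fc by (simp add: \<phi>_def)
    show "\<phi> i (x \<oplus>\<^bsub>M\<^esub> y) = \<phi> i x \<oplus> \<phi> i y" if y: "y \<in> carrier M" for y
      using \<phi>[OF has_add[OF Q[OF x] Q[OF y] x y] _ i] x y Qc[OF x i] Qc[OF y i] fc
      by (simp add: \<phi>_def R.r_distr)
  next
    fix c x assume c: "c \<in> carrier R" and x: "x \<in> carrier M"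
    show "\<phi> i (c \<odot>\<^bsub>M\<^esub> x) = c \<otimes> \<phi> i x"
      using \<phi>[OF has_smult[OF Q[OF x] c x] _ i] x c Qc[OF x i] fc by (simp add: \<phi>_def R.m_lcomm)
  next
    fix x assume "x \<in> {\<zero>\<^bsub>M\<^esub>}"
    then show "\<phi> i x = \<zero>" using \<phi>[OF has0 _ i] fc by simp
  qed
  have "finite_rank R M (carrier M) {\<zero>\<^bsub>M\<^esub>} (\<lambda>x. \<Oplus>\<^bsub>M\<^esub>i\<in>{..<r}. \<phi> i x \<odot>\<^bsub>M\<^esub> m i)"
    by (rule finite_rank_finsum[OF carrier_is_submodule]) (use form m in auto)
  moreover have "f [^] (N + L) \<odot>\<^bsub>M\<^esub> x = (\<Oplus>\<^bsub>M\<^esub>i\<in>{..<r}. \<phi> i x \<odot>\<^bsub>M\<^esub> m i)" if x: "x \<in> carrier M" for x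
  proof -
    have "(\<Oplus>\<^bsub>M\<^esub>i\<in>{..<r}. \<phi> i x \<odot>\<^bsub>M\<^esub> m i) = lincomb m (\<lambda>i. f [^] N \<otimes> Q x i) r"
      by (simp add: lincomb_def \<phi>_def)
    also have "\<dots> = f [^] N \<odot>\<^bsub>M\<^esub> lincomb m (Q x) r"
      by (rule lincomb_smult) (use m Qc[OF x] fc in auto)
    also have "\<dots> = f [^] N \<odot>\<^bsub>M\<^esub> (f [^] L \<odot>\<^bsub>M\<^esub> x)"
      using Q[OF x] by (simp add: has_def)
    finally show ?thesis using x f by (simp add: smult_assoc1[symmetric] R.nat_pow_mult)
  qed
  ultimately have "finite_rank R M (carrier M) {\<zero>\<^bsub>M\<^esub>} (\<lambda>x. f [^] (N + L) \<odot>\<^bsub>M\<^esub> x)"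
    by (rule finite_rank_cong)
  then show ?thesis by blast
qed

lemma locally_free_splits:
  assumes noeth: "noetherian_ring R" and lf: "locally_free_of_rank R M r"
  shows "splits R M (carrier M) {\<zero>\<^bsub>M\<^esub>}"
proof -
  obtain T where T: "finite T" "T \<subseteq> carrier M" "span T = carrier M"
    using locally_free_finitely_generated[OF noeth lf] .
  let ?fr = "finite_rank R M (carrier M) {\<zero>\<^bsub>M\<^esub>}"
  let ?J = "{f \<in> carrier R. ?fr (\<lambda>x. f \<odot>\<^bsub>M\<^esub> x)}"
  have ideal: "ideal ?J R"
  proof (rule R.ideal_cringI)
    show "\<zero> \<in> ?J" by (auto intro: finite_rank.zero)
    show "a \<oplus> b \<in> ?J" if "a \<in> ?J" "b \<in> ?J" for a b
    proof -
      have "?fr (\<lambda>x. a \<odot>\<^bsub>M\<^esub> x \<oplus>\<^bsub>M\<^esub> b \<odot>\<^bsub>M\<^esub> x)"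
        by (rule finite_rank_add[OF _ _ carrier_is_submodule]) (use that in auto)
      then have "?fr (\<lambda>x. (a \<oplus> b) \<odot>\<^bsub>M\<^esub> x)"
        by (rule finite_rank_cong) (use that in \<open>auto simp: smult_l_distr\<close>)
      then show ?thesis using that by simp
    qed
    show "y \<otimes> a \<in> ?J" if "a \<in> ?J" "y \<in> carrier R" for a y
    proof -
      have "?fr (\<lambda>x. y \<odot>\<^bsub>M\<^esub> (a \<odot>\<^bsub>M\<^esub> x))"
        by (rule finite_rank_scale[OF _ carrier_is_submodule]) (use that in auto)
      then have "?fr (\<lambda>x. (y \<otimes> a) \<odot>\<^bsub>M\<^esub> x)"
        by (rule finite_rank_cong) (use that in \<open>auto simp: smult_assoc1\<close>)
      then show ?thesis using that by simp
    qed
  qed blast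
  have "?J = carrier R"
  proof (rule ccontr)
    assume "?J \<noteq> carrier R"
    then obtain P where P: "primeideal P R" "?J \<subseteq> P"
      using R.prime_ideal_exists[OF noeth ideal] by blast
    then obtain f where f: "f \<in> carrier R" "f \<notin> P"
      and free: "free_of_rank (loc_ring R (powers R f)) (loc_module R (powers R f) M) r"
      using lf unfolding locally_free_of_rank_def by blast
    obtain k :: nat where "?fr (\<lambda>x. f [^] k \<odot>\<^bsub>M\<^esub> x)"
      using finite_rank_of_local_basis[OF noeth f(1) free T] by blast
    then have "f [^] k \<in> P" using f(1) P(2) by auto
    then show False using primeideal.nat_pow_mem[OF P(1) f(1)] f(2) by blast
  qed
  then have "\<one> \<in> ?J" by simp
  then have "?fr (\<lambda>x. \<one> \<odot>\<^bsub>M\<^esub> x)" by blast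
  moreover have "x \<ominus>\<^bsub>M\<^esub> \<one> \<odot>\<^bsub>M\<^esub> x \<in> {\<zero>\<^bsub>M\<^esub>}" if "x \<in> carrier M" for x
    using that by (simp add: a_minus_def M.r_neg)
  ultimately show ?thesis unfolding splits_def by blast
qed

end

section \<open>The filtered pieces\<close>

text \<open>The graded piece is a module of cosets over \<open>A\<close>, whereas a splitting lives
  in \<open>C\<close> over \<open>K\<close>. The coset map respects both structures and serves as
  the \<open>\<pi>\<close> of \<open>splits_lift\<close>.\<close>

lemma gr_splits:
  assumes "algebra K A" "noetherian_ring K" "filtered_module A FA C FC"
    and lf: "locally_free_of_rank K (restrict_scalars A (gr C FC n)) r"
  shows "splits K (restrict_scalars A C) (FC n) (FC (n + 1))"
proof -
  interpret A: algebra K A by fact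
  interpret C: filtered_module A FA C FC by fact
  let ?H = "FC n" and ?N = "FC (n + 1)"
  let ?C' = "C\<lparr>carrier := ?H\<rparr>"
  interpret V: module K "restrict_scalars A C"
    by (rule A.module_restrict_scalars) (rule C.module_axioms)
  interpret C': module A ?C'
    by (rule submodule.submodule_is_module[OF C.filt_submodule C.module_axioms])
  have N: "submodule ?N A ?C'"
    by (rule C.submodule_sub_module[OF C.filt_submodule C.filt_submodule C.filt_desc])
  interpret N: abelian_subgroup ?N ?C' by (rule C'.submodule_abelian_subgroup[OF N])
  let ?Q = "restrict_scalars A (gr C FC n)"
  have Q: "module K ?Q"
    unfolding gr_def by (rule A.module_restrict_scalars[OF C'.module_quot_module[OF N]])
  show ?thesis
  proof (rule V.splits_lift[OF Q module.locally_free_splits[OF Q assms(2) lf]])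
    show "submodule ?H K (restrict_scalars A C)"
      by (rule A.submodule_restrict_scalars[OF C.module_axioms C.filt_submodule])
    show "(\<lambda>x. ?N +>\<^bsub>?C'\<^esub> x) ` ?H = carrier ?Q"
      by (auto simp: gr_def A_RCOSETS_def')
    show "?N +>\<^bsub>?C'\<^esub> x = \<zero>\<^bsub>?Q\<^esub> \<longleftrightarrow> x \<in> ?N" if "x \<in> ?H" for x
      using that N.a_rcos_const[of x] C'.a_coset_join1[OF _ _ N.a_subgroup, of x] by (auto simp: gr_def)
    show "?N \<subseteq> ?H" by (rule C.filt_desc)
    show "?N +>\<^bsub>?C'\<^esub> (x \<oplus>\<^bsub>restrict_scalars A C\<^esub> y) = (?N +>\<^bsub>?C'\<^esub> x) \<oplus>\<^bsub>?Q\<^esub> (?N +>\<^bsub>?C'\<^esub> y)"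
      if "x \<in> ?H" "y \<in> ?H" for x y
      using that N.a_rcos_sum[of x y] by (simp add: gr_def)
    show "?N +>\<^bsub>?C'\<^esub> (a \<odot>\<^bsub>restrict_scalars A C\<^esub> x) = a \<odot>\<^bsub>?Q\<^esub> (?N +>\<^bsub>?C'\<^esub> x)"
      if "a \<in> carrier K" "x \<in> ?H" for a x
      using that C'.quot_module_smult[OF N, of "a \<odot>\<^bsub>A\<^esub> \<one>\<^bsub>A\<^esub>" x] by (simp add: gr_def)
  qed
qed

text \<open>The induction starts at an index where the filtration is all of \<open>C\<close>, so
  that there is nothing to split, and adds one graded piece at a time. An index at which the
  filtration vanishes yields a decomposition of the identity of \<open>C\<close> itself.\<close>

lemma AF_module_splits:
  assumes alg: "algebra K A" and noeth: "noetherian_ring K" and AF: "AF_module K A FA C FC"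
  shows "splits K (restrict_scalars A C) (carrier C) (FC n)"
proof -
  interpret A: algebra K A by fact
  interpret C: filtered_module A FA C FC using AF by (simp add: AF_module_def)
  interpret V: module K "restrict_scalars A C"
    by (rule A.module_restrict_scalars) (rule C.module_axioms)
  have sub: "submodule (FC k) K (restrict_scalars A C)" for k
    by (rule A.submodule_restrict_scalars[OF C.module_axioms C.filt_submodule])
  obtain n0 where n0: "\<And>k. k \<le> n0 \<Longrightarrow> FC k = carrier C"
    using AF unfolding AF_module_def by blast
  have refl: "splits K (restrict_scalars A C) (carrier C) (FC k)" if "k \<le> n0" for k
    using V.splits_refl[OF sub[of k]] n0[OF that] by simp
  show ?thesis
  proof (cases "n \<le> n0")
    case False
    then have "n0 \<le> n" by simp
    then show ?thesis
    proof (induction n rule: int_ge_induct)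
      case (step k)
      obtain r where "locally_free_of_rank K (restrict_scalars A (gr C FC k)) r"
        using AF unfolding AF_module_def by blast
      then have "splits K (restrict_scalars A C) (FC k) (FC (k + 1))"
        using gr_splits[OF alg noeth C.filtered_module_axioms] by blast
      with step.IH show ?case
        using V.splits_trans[of "carrier C" "FC k" "FC (k + 1)"] sub V.carrier_is_submodule
          C.submoduleE(1)[OF C.filt_submodule] C.filt_desc by auto
    qed (simp add: refl)
  qed (rule refl)
qed

section \<open>The socle as a filtered submodule\<close>

lemma (in filtered_module) Soc_submodule:
  assumes "ideal (FA 1) A"
  shows "submodule (Soc FA C) A C"
proof (rule submoduleI)
  have I: "a \<in> carrier A" if "a \<in> FA 1" for a
    using additive_subgroup.a_Hcarr[OF ideal.axioms(1)[OF assms] that] .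
  show "\<zero>\<^bsub>C\<^esub> \<in> Soc FA C" using I by (simp add: Soc_def)
  show "\<ominus>\<^bsub>C\<^esub> c \<in> Soc FA C" if "c \<in> Soc FA C" for c
    using that I smult_r_minus[of _ c] M.minus_equality[of "\<zero>\<^bsub>C\<^esub>" "\<zero>\<^bsub>C\<^esub>"] by (simp add: Soc_def)
  show "c \<oplus>\<^bsub>C\<^esub> d \<in> Soc FA C" if "c \<in> Soc FA C" "d \<in> Soc FA C" for c d
    using that I by (simp add: Soc_def smult_r_distr)
  show "a \<odot>\<^bsub>C\<^esub> c \<in> Soc FA C" if a: "a \<in> carrier A" and c: "c \<in> Soc FA C" for a c
  proof -
    have "b \<odot>\<^bsub>C\<^esub> (a \<odot>\<^bsub>C\<^esub> c) = \<zero>\<^bsub>C\<^esub>" if "b \<in> FA 1" for b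
    proof -
      have "b \<odot>\<^bsub>C\<^esub> (a \<odot>\<^bsub>C\<^esub> c) = (b \<otimes>\<^bsub>A\<^esub> a) \<odot>\<^bsub>C\<^esub> c"
        using a c I[OF that] by (simp add: Soc_def smult_assoc1)
      then show ?thesis using c ideal.I_r_closed[OF assms that a] by (simp add: Soc_def)
    qed
    then show ?thesis using a c by (simp add: Soc_def)
  qed
qed (auto simp: Soc_def)

lemma (in filtered_module) filtered_module_Soc:
  assumes "ideal (FA 1) A" and FA: "\<And>m. FA m \<subseteq> carrier A"
  shows "filtered_module A FA (Soc_module FA C) (Soc_filt FA C FC)"
proof -
  note S = Soc_submodule[OF assms(1)]
  have sub: "submodule (Soc FA C \<inter> FC n) A C" for n
    using submodule_Inter[of "{Soc FA C, FC n}"] S filt_submodule by auto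
  show ?thesis
    unfolding Soc_module_def Soc_filt_def
  proof (intro filtered_module.intro filtered_module_axioms.intro)
    show "module A (C\<lparr>carrier := Soc FA C\<rparr>)"
      by (rule submodule.submodule_is_module[OF S]) (rule module_axioms)
    show "submodule (Soc FA C \<inter> FC n) A (C\<lparr>carrier := Soc FA C\<rparr>)" for n
      by (rule submodule_sub_module[OF sub S]) simp
    show "Soc FA C \<inter> FC (n + 1) \<subseteq> Soc FA C \<inter> FC n" for n
      using filt_desc[of n] by blast
  next
    fix a m x n assume a: "a \<in> FA m" and x: "x \<in> Soc FA C \<inter> FC n"
    show "a \<odot>\<^bsub>C\<lparr>carrier := Soc FA C\<rparr>\<^esub> x \<in> Soc FA C \<inter> FC (m + n)"
      using submoduleE(4)[OF S, of a x] filt_smult[OF a, of x n] FA[of m] a x by auto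
  qed
qed

section \<open>The canonical isomorphism\<close>

theorem mainTheorem12:
  fixes K :: "('k, 'r) ring_scheme"
    and A :: "('k, 'a, 'm) module_scheme" and FA :: "int \<Rightarrow> 'a set"
    and C :: "('a, 'c, 'n) module_scheme" and FC :: "int \<Rightarrow> 'c set"
  assumes "cring K" and "noetherian_ring K"
    and "filtered_algebra K A FA"
    and "(\<lambda>r. FA 1 +>\<^bsub>A\<^esub> (r \<odot>\<^bsub>A\<^esub> \<one>\<^bsub>A\<^esub>)) \<in> ring_iso K (A Quot FA 1)"
    and "AF_module K A FA C FC"
  shows "let D = dual K A C; FD = dual_filt K A C FC;
             T = tensor_k A FA D; FT = tensor_k_filt A FA D FD
         in \<exists>\<Phi>. filtered_module_iso A FA
                  (Soc_module FA C) (Soc_filt FA C FC) (dual K A T) (dual_filt K A T FT) \<Phi> \<and>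
                (\<forall>c\<in>Soc FA C. \<forall>f\<in>carrier D. \<Phi> c (tensor_k_proj A FA D f) = f c)"
proof -
  interpret A: filtered_algebra K A FA by fact
  interpret C: filtered_module A FA C FC using assms(5) by (simp add: AF_module_def)
  interpret V: module K "restrict_scalars A C"
    by (rule A.module_restrict_scalars) (rule C.module_axioms)
  have alg: "algebra K A" by (rule A.algebra_axioms)
  have FA_sub: "FA m \<subseteq> carrier A" for m
    using additive_subgroup.a_subset[OF ideal.axioms(1)[OF A.filt_ideal]] .
  define D where "D = dual K A C"
  define L where "L = carrier D"
  define T where "T = tensor_k A FA D"
  define \<pi> where "\<pi> = tensor_k_proj A FA D"
  define J where "J = ideal_smult A (FA 1) D"
  define E where "E = dual K A T"
  interpret D: module A D unfolding D_def by (rule A.module_dual) (rule C.module_axioms)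
  have J: "submodule J A D" unfolding J_def by (rule D.submodule_ideal_smult[OF FA_sub])
  interpret J: abelian_subgroup J D by (rule D.submodule_abelian_subgroup[OF J])
  have T_eq: "T = quot_module D J" by (simp add: T_def tensor_k_def J_def)
  interpret T: module A T unfolding T_eq by (rule D.module_quot_module[OF J])
  interpret E: module A E unfolding E_def by (rule A.module_dual) (rule T.module_axioms)
  interpret W: module K "restrict_scalars A T"
    by (rule A.module_restrict_scalars) (rule T.module_axioms)
  have \<pi>: "\<pi> f = J +>\<^bsub>D\<^esub> f" for f by (simp add: \<pi>_def tensor_k_proj_def J_def)
  have T_carrier: "carrier T = \<pi> ` L" by (auto simp: T_eq \<pi> L_def A_RCOSETS_def')
  have \<pi>_add: "\<pi> f \<oplus>\<^bsub>T\<^esub> \<pi> g = \<pi> (f \<oplus>\<^bsub>D\<^esub> g)" if "f \<in> L" "g \<in> L" for f g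
    using that by (simp add: T_eq \<pi> L_def J.a_rcos_sum)
  have \<pi>_smult: "a \<odot>\<^bsub>T\<^esub> \<pi> f = \<pi> (a \<odot>\<^bsub>D\<^esub> f)" if "a \<in> carrier A" "f \<in> L" for a f
    using that D.quot_module_smult[OF J] by (simp add: T_eq \<pi> L_def)
  have \<pi>_closed: "\<pi> f \<in> carrier T" if "f \<in> L" for f using that T_carrier by blast
  have L_eq: "L = linear_forms K (restrict_scalars A C)" by (simp add: L_def D_def)
  have E_carrier: "carrier E = linear_forms K (restrict_scalars A T)" by (simp add: E_def)
  note lf = linear_formsD[of _ K "restrict_scalars A C", folded L_eq, simplified]
  note lE = linear_formsD[of _ K "restrict_scalars A T", folded E_carrier, simplified]
  have D_add: "(f \<oplus>\<^bsub>D\<^esub> g) c = f c \<oplus>\<^bsub>K\<^esub> g c" if "c \<in> carrier C" for f g c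
    using that by (simp add: D_def)
  have D_smult: "(a \<odot>\<^bsub>D\<^esub> f) c = f (a \<odot>\<^bsub>C\<^esub> c)" if "c \<in> carrier C" for a f c
    using that by (simp add: D_def)
  have splits: "splits K (restrict_scalars A C) (carrier (restrict_scalars A C)) (FC n)" for n
    using AF_module_splits[OF alg assms(2,5)] by simp
  have FC_sub: "FC n \<subseteq> carrier C" for n by (rule C.submoduleE(1)[OF C.filt_submodule])
  have torsionless: "c \<in> FC n"
    if "c \<in> carrier C" "\<And>f. \<lbrakk>f \<in> L; \<And>x. x \<in> FC n \<Longrightarrow> f x = \<zero>\<^bsub>K\<^esub>\<rbrakk> \<Longrightarrow> f c = \<zero>\<^bsub>K\<^esub>" for c n
    using V.splits_torsionless[OF splits[of n], of c] FC_sub that by (simp add: L_eq)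
  \<comment> \<open>At an index where the filtration vanishes, \<open>torsionless\<close> says that
    the forms separate the points of \<open>C\<close>.\<close>
  obtain n1 where n1: "FC n1 = {\<zero>\<^bsub>C\<^esub>}"
    using assms(5) unfolding AF_module_def by blast
  have separated: "c = \<zero>\<^bsub>C\<^esub>" if "c \<in> carrier C" "\<And>f. f \<in> L \<Longrightarrow> f c = \<zero>\<^bsub>K\<^esub>" for c
    using torsionless[of c n1] that n1 by blast
  have Soc_sub: "submodule (Soc FA C) A C" by (rule C.Soc_submodule[OF A.filt_ideal])
  have Soc_carrier: "c \<in> carrier C" if "c \<in> Soc FA C" for c using that by (simp add: Soc_def)
  have L_zero: "f \<zero>\<^bsub>C\<^esub> = \<zero>\<^bsub>K\<^esub>" if "f \<in> L" for f
    using lf(4)[OF that A.R.zero_closed C.M.zero_closed] lf(1)[OF that C.M.zero_closed] by simp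
  have J_vanish: "g c = \<zero>\<^bsub>K\<^esub>" if c: "c \<in> Soc FA C" and g: "g \<in> J" for c g
  proof -
    \<comment> \<open>Asking for vanishing on all of \<open>A c\<close>, and not only at
      \<open>c\<close>, makes stability under \<open>A\<close> immediate; this matters because
      \<open>J\<close> is minimal among \<open>A\<close>-submodules.\<close>
    let ?N = "{g \<in> L. \<forall>a\<in>carrier A. g (a \<odot>\<^bsub>C\<^esub> c) = \<zero>\<^bsub>K\<^esub>}"
    have Lc: "f \<in> carrier D \<longleftrightarrow> f \<in> L" for f by (simp add: L_def)
    note cc = Soc_carrier[OF c]
    have sm: "submodule ?N A D"
    proof (rule D.submoduleI)
      show sm: "a \<odot>\<^bsub>D\<^esub> g \<in> ?N" if "a \<in> carrier A" "g \<in> ?N" for a g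
      proof -
        have "(a \<odot>\<^bsub>D\<^esub> g) (b \<odot>\<^bsub>C\<^esub> c) = \<zero>\<^bsub>K\<^esub>" if b: "b \<in> carrier A" for b
        proof -
          have "(a \<odot>\<^bsub>D\<^esub> g) (b \<odot>\<^bsub>C\<^esub> c) = g ((a \<otimes>\<^bsub>A\<^esub> b) \<odot>\<^bsub>C\<^esub> c)"
            using b cc \<open>a \<in> carrier A\<close> by (simp add: D_smult C.smult_assoc1)
          then show ?thesis using b that \<open>a \<in> carrier A\<close> \<open>g \<in> ?N\<close> by simp
        qed
        moreover have "a \<odot>\<^bsub>D\<^esub> g \<in> L" using that by (simp add: L_def)
        ultimately show ?thesis by simp
      qed
      show "\<ominus>\<^bsub>D\<^esub> g \<in> ?N" if "g \<in> ?N" for g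
        using sm[of "\<ominus>\<^bsub>A\<^esub> \<one>\<^bsub>A\<^esub>" g] that D.smult_l_minus[of "\<one>\<^bsub>A\<^esub>" g] by (simp add: Lc)
      show "f \<oplus>\<^bsub>D\<^esub> g \<in> ?N" if "f \<in> ?N" "g \<in> ?N" for f g
        using that cc D.M.a_closed[of f g] by (simp add: D_add Lc)
      have "\<zero>\<^bsub>D\<^esub> \<in> L" unfolding L_def by (rule D.M.zero_closed)
      moreover have "\<zero>\<^bsub>D\<^esub> (a \<odot>\<^bsub>C\<^esub> c) = \<zero>\<^bsub>K\<^esub>" if "a \<in> carrier A" for a
        using that cc by (simp add: D_def)
      ultimately show "\<zero>\<^bsub>D\<^esub> \<in> ?N" by blast
    qed (auto simp: L_def)
    have "J \<subseteq> ?N"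
      unfolding J_def
    proof (rule D.ideal_smult_minimal[OF sm])
      fix b f assume b: "b \<in> FA 1" and f: "f \<in> carrier D"
      have bA: "b \<in> carrier A" using b FA_sub by blast
      have "(b \<odot>\<^bsub>D\<^esub> f) (a \<odot>\<^bsub>C\<^esub> c) = \<zero>\<^bsub>K\<^esub>" if a: "a \<in> carrier A" for a
      proof -
        have "a \<odot>\<^bsub>C\<^esub> c \<in> Soc FA C" using C.submoduleE(4)[OF Soc_sub a c] .
        then have "b \<odot>\<^bsub>C\<^esub> (a \<odot>\<^bsub>C\<^esub> c) = \<zero>\<^bsub>C\<^esub>" using b by (simp add: Soc_def)
        then show ?thesis using a cc f L_zero by (simp add: D_smult Lc)
      qed
      moreover have "b \<odot>\<^bsub>D\<^esub> f \<in> L" using bA f by (simp add: L_def)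
      ultimately show "b \<odot>\<^bsub>D\<^esub> f \<in> ?N" by simp
    qed
    then have "g (\<one>\<^bsub>A\<^esub> \<odot>\<^bsub>C\<^esub> c) = \<zero>\<^bsub>K\<^esub>" using g by blast
    then show ?thesis using cc by simp
  qed
  have \<pi>_eval: "f c = g c" if "\<pi> f = \<pi> g" "f \<in> L" "g \<in> L" "c \<in> Soc FA C" for f g c
  proof -
    have "f \<in> J +>\<^bsub>D\<^esub> g" using J.a_rcos_self[of f] that by (simp add: \<pi> L_def)
    then obtain h where h: "h \<in> J" "f = h \<oplus>\<^bsub>D\<^esub> g" by (auto simp: a_r_coset_def')
    then show ?thesis
      using J_vanish[OF that(4) h(1)] Soc_carrier[OF that(4)] lf(1)[OF that(3)] by (simp add: D_add)
  qed
  \<comment> \<open>A representative of each coset is chosen; by \<open>\<pi>_eval\<close> its value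
    at a socle element does not depend on the choice. The restriction to \<open>carrier T\<close>
    reflects that forms are extensional.\<close>
  define \<Phi> where "\<Phi> c = (\<lambda>X\<in>carrier T. (SOME f. f \<in> L \<and> \<pi> f = X) c)" for c
  have \<Phi>: "\<Phi> c (\<pi> f) = f c" if "c \<in> Soc FA C" "f \<in> L" for c f
  proof -
    have "(SOME g. g \<in> L \<and> \<pi> g = \<pi> f) \<in> L \<and> \<pi> (SOME g. g \<in> L \<and> \<pi> g = \<pi> f) = \<pi> f"
      by (rule someI[of _ f]) (use that in simp)
    then show ?thesis using \<pi>_eval[OF _ _ that(2,1)] \<pi>_closed[OF that(2)] by (simp add: \<Phi>_def)
  qed
  have unit: "r \<odot>\<^bsub>A\<^esub> \<one>\<^bsub>A\<^esub> \<in> carrier A" if "r \<in> carrier K" for r using that by simp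
  have \<Phi>_closed: "\<Phi> c \<in> carrier E" if c: "c \<in> Soc FA C" for c
  proof -
    have "(\<lambda>X\<in>carrier (restrict_scalars A T). \<Phi> c X) \<in> linear_forms K (restrict_scalars A T)"
    proof (rule W.restrict_linear_formI)
      fix X Y assume "X \<in> carrier (restrict_scalars A T)" "Y \<in> carrier (restrict_scalars A T)"
      then obtain f g where f: "f \<in> L" "X = \<pi> f" and g: "g \<in> L" "Y = \<pi> g" using T_carrier by auto
      have "f \<oplus>\<^bsub>D\<^esub> g \<in> L" using f g by (simp add: L_def)
      then show "\<Phi> c (X \<oplus>\<^bsub>restrict_scalars A T\<^esub> Y) = \<Phi> c X \<oplus>\<^bsub>K\<^esub> \<Phi> c Y"
        using f g c Soc_carrier[OF c] by (simp add: \<pi>_add \<Phi> D_add)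
    next
      fix X assume "X \<in> carrier (restrict_scalars A T)"
      then obtain f where f: "f \<in> L" "X = \<pi> f" using T_carrier by auto
      show "\<Phi> c X \<in> carrier K" using f c Soc_carrier[OF c] by (simp add: \<Phi> lf(1))
      fix r assume r: "r \<in> carrier K"
      have "(r \<odot>\<^bsub>A\<^esub> \<one>\<^bsub>A\<^esub>) \<odot>\<^bsub>D\<^esub> f \<in> L" using unit[OF r] f by (simp add: L_def)
      then show "\<Phi> c (r \<odot>\<^bsub>restrict_scalars A T\<^esub> X) = r \<otimes>\<^bsub>K\<^esub> \<Phi> c X"
        using f c r unit[OF r] Soc_carrier[OF c] lf(4)[OF f(1) r] by (simp add: \<pi>_smult \<Phi> D_smult)
    qed
    moreover have "(\<lambda>X\<in>carrier T. \<Phi> c X) = \<Phi> c" by (simp add: \<Phi>_def restrict_def fun_eq_iff)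
    ultimately show ?thesis by (simp add: E_carrier)
  qed
  have E_eqI: "G = H" if "G \<in> carrier E" "H \<in> carrier E" "\<And>f. f \<in> L \<Longrightarrow> G (\<pi> f) = H (\<pi> f)" for G H
    by (rule linear_forms_eqI[of _ K "restrict_scalars A T"]) (use that T_carrier in \<open>auto simp: E_carrier\<close>)
  have \<Phi>_inj: "c = d" if c: "c \<in> Soc FA C" and d: "d \<in> Soc FA C" and eq: "\<Phi> c = \<Phi> d" for c d
  proof -
    have cd: "c \<in> carrier C" "d \<in> carrier C" using c d Soc_carrier by auto
    have m: "c \<ominus>\<^bsub>C\<^esub> d \<in> Soc FA C" by (rule C.submodule_minus[OF Soc_sub c d])
    have "f (c \<ominus>\<^bsub>C\<^esub> d) = \<zero>\<^bsub>K\<^esub>" if f: "f \<in> L" for f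
    proof -
      have "f c = f d" using \<Phi>[OF c f] \<Phi>[OF d f] eq by simp
      moreover have "f c = f (c \<ominus>\<^bsub>C\<^esub> d) \<oplus>\<^bsub>K\<^esub> f d"
        using lf(3)[OF f Soc_carrier[OF m] cd(2)] cd by (simp add: a_minus_def C.M.a_assoc C.M.l_neg)
      ultimately show ?thesis using lf(1)[OF f cd(2)] lf(1)[OF f Soc_carrier[OF m]] by simp
    qed
    then have "c \<ominus>\<^bsub>C\<^esub> d = \<zero>\<^bsub>C\<^esub>" using separated Soc_carrier[OF m] by blast
    then show ?thesis using C.minus_eq_zeroD cd by metis
  qed
  have \<Phi>_surj: "\<exists>c\<in>Soc FA C. \<Phi> c = G" if G: "G \<in> carrier E" for G
  proof -
    \<comment> \<open>\<open>G\<close> composed with \<open>\<pi>\<close> is a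
      \<open>K\<close>-linear functional on the dual of \<open>C\<close>, hence evaluation at some
      \<open>c\<close> by reflexivity.\<close>
    have "\<exists>c\<in>carrier (restrict_scalars A C). \<forall>f\<in>linear_forms K (restrict_scalars A C). G (\<pi> f) = f c"
    proof (rule V.splits_reflexive, goal_cases)
      case 1
      then show ?case using splits[of n1] n1 by simp
    next
      case (2 f)
      then show ?case using lE(1)[OF G] \<pi>_closed by (simp add: L_eq)
    next
      case (3 f g)
      then have fg: "f \<in> L" "g \<in> L" by (simp_all add: L_eq)
      have "(\<lambda>x\<in>carrier (restrict_scalars A C). f x \<oplus>\<^bsub>K\<^esub> g x) = f \<oplus>\<^bsub>D\<^esub> g" by (simp add: D_def)
      then show ?case using lE(3)[OF G \<pi>_closed[OF fg(1)] \<pi>_closed[OF fg(2)]] fg by (simp add: \<pi>_add)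
    next
      case (4 r f)
      then have f: "f \<in> L" and r: "r \<in> carrier K" by (simp_all add: L_eq)
      have "(\<lambda>x\<in>carrier (restrict_scalars A C). r \<otimes>\<^bsub>K\<^esub> f x) = (r \<odot>\<^bsub>A\<^esub> \<one>\<^bsub>A\<^esub>) \<odot>\<^bsub>D\<^esub> f"
        using lf(4)[OF f r] by (auto simp: D_def intro!: restrict_ext)
      then show ?case using lE(4)[OF G r \<pi>_closed[OF f]] f unit[OF r] by (simp add: \<pi>_smult)
    qed
    then obtain c where c: "c \<in> carrier C" "\<And>f. f \<in> L \<Longrightarrow> G (\<pi> f) = f c"
      by (auto simp: L_eq)
    \<comment> \<open>For \<open>a \<in> FA 1\<close> the form \<open>a f\<close> lies in
      \<open>J\<close>, so \<open>f (a c) = (a f) c = G (\<pi> (a f))\<close> is the value of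
      \<open>G\<close> at zero. As the forms separate points, \<open>a c\<close> is zero.\<close>
    have "a \<odot>\<^bsub>C\<^esub> c = \<zero>\<^bsub>C\<^esub>" if a: "a \<in> FA 1" for a
    proof (rule separated)
      have aA: "a \<in> carrier A" using a FA_sub by blast
      then show "a \<odot>\<^bsub>C\<^esub> c \<in> carrier C" using c by simp
      fix f assume f: "f \<in> L"
      have af: "a \<odot>\<^bsub>D\<^esub> f \<in> L" "a \<odot>\<^bsub>D\<^esub> f \<in> J"
        using aA f a D.ideal_smult_incl by (simp_all add: L_def J_def)
      have "\<zero>\<^bsub>T\<^esub> = \<pi> (a \<odot>\<^bsub>D\<^esub> f)" using J.a_rcos_const[OF af(2)] by (simp add: T_eq \<pi>)
      moreover have "G \<zero>\<^bsub>T\<^esub> = \<zero>\<^bsub>K\<^esub>"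
        using lE(4)[OF G A.R.zero_closed T.M.zero_closed] lE(1)[OF G T.M.zero_closed] by simp
      ultimately show "f (a \<odot>\<^bsub>C\<^esub> c) = \<zero>\<^bsub>K\<^esub>" using c af(1) by (simp add: D_smult)
    qed
    then have S: "c \<in> Soc FA C" using c by (simp add: Soc_def)
    moreover have "\<Phi> c = G"
      by (rule E_eqI[OF \<Phi>_closed[OF S] G]) (simp add: \<Phi>[OF S] c)
    ultimately show ?thesis by blast
  qed
  have iso: "\<Phi> \<in> module_iso A (Soc_module FA C) E"
    unfolding module_iso_def mem_Collect_eq
  proof (intro conjI ballI)
    show "bij_betw \<Phi> (carrier (Soc_module FA C)) (carrier E)"
    proof (rule bij_betw_imageI)
      show "inj_on \<Phi> (carrier (Soc_module FA C))"
        by (rule inj_onI) (simp add: Soc_module_def \<Phi>_inj)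
      show "\<Phi> ` carrier (Soc_module FA C) = carrier E"
        using \<Phi>_closed \<Phi>_surj by (fastforce simp: Soc_module_def)
    qed
  next
    fix c d assume "c \<in> carrier (Soc_module FA C)" "d \<in> carrier (Soc_module FA C)"
    then have c: "c \<in> Soc FA C" and d: "d \<in> Soc FA C" by (simp_all add: Soc_module_def)
    have cd: "c \<oplus>\<^bsub>C\<^esub> d \<in> Soc FA C" by (rule C.submoduleE(5)[OF Soc_sub c d])
    have "\<Phi> (c \<oplus>\<^bsub>C\<^esub> d) = \<Phi> c \<oplus>\<^bsub>E\<^esub> \<Phi> d"
    proof (rule E_eqI[OF \<Phi>_closed[OF cd] E.M.a_closed[OF \<Phi>_closed[OF c] \<Phi>_closed[OF d]]])
      show "\<Phi> (c \<oplus>\<^bsub>C\<^esub> d) (\<pi> f) = (\<Phi> c \<oplus>\<^bsub>E\<^esub> \<Phi> d) (\<pi> f)" if f: "f \<in> L" for f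
        using \<pi>_closed[OF f] lf(3)[OF f Soc_carrier[OF c] Soc_carrier[OF d]]
        by (simp add: E_def \<Phi> c d cd f)
    qed
    then show "\<Phi> (c \<oplus>\<^bsub>Soc_module FA C\<^esub> d) = \<Phi> c \<oplus>\<^bsub>E\<^esub> \<Phi> d" by (simp add: Soc_module_def)
  next
    fix a c assume a: "a \<in> carrier A" and "c \<in> carrier (Soc_module FA C)"
    then have c: "c \<in> Soc FA C" by (simp add: Soc_module_def)
    have ac: "a \<odot>\<^bsub>C\<^esub> c \<in> Soc FA C" by (rule C.submoduleE(4)[OF Soc_sub a c])
    have "\<Phi> (a \<odot>\<^bsub>C\<^esub> c) = a \<odot>\<^bsub>E\<^esub> \<Phi> c"
    proof (rule E_eqI[OF \<Phi>_closed[OF ac] E.smult_closed[OF a \<Phi>_closed[OF c]]])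
      fix f assume f: "f \<in> L"
      have "a \<odot>\<^bsub>D\<^esub> f \<in> L" using a f by (simp add: L_def)
      then show "\<Phi> (a \<odot>\<^bsub>C\<^esub> c) (\<pi> f) = (a \<odot>\<^bsub>E\<^esub> \<Phi> c) (\<pi> f)"
        using \<pi>_closed[OF f] Soc_carrier[OF c] a f by (simp add: E_def \<Phi> c ac \<pi>_smult D_smult)
    qed
    then show "\<Phi> (a \<odot>\<^bsub>Soc_module FA C\<^esub> c) = a \<odot>\<^bsub>E\<^esub> \<Phi> c" by (simp add: Soc_module_def)
  qed
  let ?FE = "dual_filt K A T (tensor_k_filt A FA D (dual_filt K A C FC))"
  have filt: "\<Phi> ` Soc_filt FA C FC n = ?FE n" for n
  proof -
    \<comment> \<open>The two shifts \<open>p \<mapsto> 1 - p\<close> cancel: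
      \<open>1 - (1 - n) = n\<close>, so that membership is tested on the forms vanishing on
      \<open>FC n\<close>.\<close>
    have FE: "G \<in> ?FE n \<longleftrightarrow> G \<in> carrier E \<and>
        (\<forall>f\<in>L. (\<forall>x\<in>FC n. f x = \<zero>\<^bsub>K\<^esub>) \<longrightarrow> G (\<pi> f) = \<zero>\<^bsub>K\<^esub>)" for G
      by (auto simp: dual_filt_def tensor_k_filt_def E_def \<pi>_def L_def D_def)
    have "\<Phi> c \<in> ?FE n \<longleftrightarrow> c \<in> FC n" if c: "c \<in> Soc FA C" for c
    proof
      \<comment> \<open>By \<open>FE\<close> every form that vanishes on \<open>FC n\<close>
        vanishes at \<open>c\<close>, which is the hypothesis of \<open>torsionless\<close>.\<close>
      show "c \<in> FC n" if "\<Phi> c \<in> ?FE n"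
        by (rule torsionless[OF Soc_carrier[OF c]]) (use that c in \<open>auto simp: FE \<Phi>\<close>)
      show "\<Phi> c \<in> ?FE n" if "c \<in> FC n"
        using that c by (auto simp: FE \<Phi> \<Phi>_closed)
    qed
    moreover have "\<exists>c\<in>Soc FA C. \<Phi> c = G" if "G \<in> ?FE n" for G
      using that \<Phi>_surj by (simp add: FE)
    ultimately show ?thesis unfolding Soc_filt_def by blast
  qed
  have "filtered_module_iso A FA (Soc_module FA C) (Soc_filt FA C FC) E ?FE \<Phi>"
    by (rule filtered_module_iso_transport[OF C.filtered_module_Soc[OF A.filt_ideal FA_sub]
          E.module_axioms iso filt FA_sub])
  \<comment> \<open>The evaluation formula expresses canonicity: every element of \<open>T\<close>
    is some \<open>\<pi> f\<close>, so the formula determines the functional assigned to each socle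
    element.\<close>
  then show ?thesis
    unfolding Let_def using \<Phi> by (fold D_def) (fold T_def E_def \<pi>_def L_def, blast)
qed

end
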